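(* For $C,D\in\mathbb{R}$ let $g_{C,D}=dx^2+dh\,dz+Cz^2dh^2+Dz\,dx\,dh$ on a neighborhood $U$ of the origin in $\mathbb{R}^3$ with coordinates $(x,h,z)$, and let $\mathfrak{g}$ be its full Killing algebra. (i) If $D\neq 0$ and $C\notin\{0,D^2\}$, then $(U,g_{C,D})$ is locally isometric to a left-invariant metric on $SL(2,\mathbb{R})$, with $\mathfrak{g}\cong\mathbb{R}\oplus\mathfrak{sl}(2,\mathbb{R})$. The isotropy is the graph of a Lie algebra homomorphism of the $\mathbb{R}$ factor to the subalgebra spanned by an $\mathbb{R}$-semisimple element of $\mathfrak{sl}(2,\mathbb{R})$. (ii) If $D\neq 0$ and $C=D^2$, then $(U,g_{C,D})$ is locally isometric to a left-invariant metric on the Heisenberg group, with $\mathfrak{g}\cong\mathbb{R}\ltimes\mathfrak{heis}$. The isotropy is the $\mathbb{R}$ factor, which acts by a semisimple automorphism of $\mathfrak{heis}$. (iii) If $C=0$ and $D\neq 0$, then $(U,g_{C,D})$ is locally isometric to $\mathrm{AdS}^3$, so $\mathfrak{g}\cong\mathfrak{sl}(2,\mathbb{R})\oplus\mathfrak{sl}(2,\mathbb{R})$. (iv) If $C\neq 0$ and $D=0$, then $(U,g_{C,D})$ is locally isometric to $\mathbb{R}\times\mathrm{dS}^2$, for which $\mathfrak{g}\cong\mathbb{R}\oplus\mathfrak{sl}(2,\mathbb{R})$. The isotropy is generated by a semisimple element of $\mathfrak{sl}(2,\mathbb{R})$. (v) If $C=0$ and $D=0$, then $(U,g_{C,D})$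 is locally isometric to $\mathrm{Min}^3$, so $\mathfrak{g}\cong\mathfrak{sl}(2,\mathbb{R})\ltimes\mathbb{R}^3$.
   Context: Convention for $g_{C,D}$: it is the Lorentz metric with $g(\partial_x,\partial_x)=1$, $g(\partial_h,\partial_z)=1$, $g(\partial_x,\partial_h)=Dz$, $g(\partial_h,\partial_h)=Cz^2$, $g(\partial_x,\partial_z)=g(\partial_z,\partial_z)=0$ (so a mixed product $dh\,dz$ means $dh\otimes dz+dz\otimes dh$). $U$ is a connected, simply connected open neighborhood of the origin. The Killing algebra $\mathfrak{g}$ is the Lie algebra of (germs of) Killing fields of $g_{C,D}$, which all extend to $U$; the isotropy is the subalgebra of $\mathfrak{g}$ of Killing fields vanishing at the origin. An element of $\mathfrak{sl}(2,\mathbb{R})$ is $\mathbb{R}$-semisimple if it is nonzero and diagonalizable over $\mathbb{R}$. $\mathrm{AdS}^n$, $\mathrm{Min}^n$, $\mathrm{dS}^n$ are the $n$-dimensional Lorentzian manifolds of constant sectional curvature $-1$, $0$, $1$ respectively. $\mathfrak{heis}$ is the three-dimensional Heisenberg Lie algebra.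
   Formalization: In (iii) the isometry is to AdS^3 with its metric multiplied by 4/D^2, and in (iv) to R×dS^2 with the dS^2 metric multiplied by 1/C (negative for C<0); with curvatures fixed at -1 and 1 the literal claims hold only for D^2=4 and C=1. *)

theory Defs
  imports "HOL-Analysis.Analysis"
begin

fun Ck_on :: "nat \<Rightarrow> ('a::euclidean_space \<Rightarrow> 'b::real_normed_vector) \<Rightarrow> 'a set \<Rightarrow> bool" where
  "Ck_on 0 f S \<longleftrightarrow> continuous_on S f"
| "Ck_on (Suc k) f S \<longleftrightarrow>
     (\<forall>x\<in>S. f differentiable (at x)) \<and>
     (\<forall>v. Ck_on k (\<lambda>x. frechet_derivative f (at x) v) S)"

(* Only used for open sets S. *)
definition smooth_on :: "'a set \<Rightarrow> ('a::euclidean_space \<Rightarrow> 'b::real_normed_vector) \<Rightarrow> bool" where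
  "smooth_on S f \<longleftrightarrow> (\<forall>k. Ck_on k f S)"

(* A metric assigns to each point a bilinear form.  On a submanifold M of a Euclidean
   space it is given by forms on the ambient space, of which only the values on vectors
   tangent to M matter. *)
type_synonym 'a metric_tensor = "'a \<Rightarrow> 'a \<Rightarrow> 'a \<Rightarrow> real"

(* U is an open subset of a Euclidean space; M is an embedded submanifold of a Euclidean
   space, of the same dimension as U.  Every point of U has a neighbourhood V with an
   isometric diffeomorphism onto an open subset of M: a smooth immersion that is a
   homeomorphism onto a relatively open subset of M is a diffeomorphism onto it. *)
definition locally_isometric ::
  "'a::euclidean_space set \<Rightarrow> 'a metric_tensor \<Rightarrow> 'b::euclidean_space set \<Rightarrow> 'b metric_tensor \<Rightarrow> bool"
where
  "locally_isometric U g M h \<longleftrightarrow>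
     (\<forall>p\<in>U. \<exists>V \<phi> \<psi>. open V \<and> p \<in> V \<and> V \<subseteq> U \<and> smooth_on V \<phi> \<and>
        openin (top_of_set M) (\<phi> ` V) \<and> homeomorphism V (\<phi> ` V) \<phi> \<psi> \<and>
        (\<forall>q\<in>V. inj (frechet_derivative \<phi> (at q)) \<and>
           (\<forall>v w. g q v w = h (\<phi> q) (frechet_derivative \<phi> (at q) v) (frechet_derivative \<phi> (at q) w))))"

definition scale_metric :: "real \<Rightarrow> 'a metric_tensor \<Rightarrow> 'a metric_tensor" where
  "scale_metric c h = (\<lambda>p v w. c * h p v w)"

definition product_metric :: "'a metric_tensor \<Rightarrow> 'b metric_tensor \<Rightarrow> ('a \<times> 'b) metric_tensor" where
  "product_metric h k = (\<lambda>p v w. h (fst p) (fst v) (fst w) + k (snd p) (snd v) (snd w))"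

(* The coordinates (x, h, z) are the components 1, 2, 3; the mixed products dh dz and
   dx dh denote dh (x) dz + dz (x) dh and dx (x) dh + dh (x) dx. *)
definition g_CD :: "real \<Rightarrow> real \<Rightarrow> (real^3) metric_tensor" where
  "g_CD C D = (\<lambda>p v w.
     v$1 * w$1 + (v$2 * w$3 + v$3 * w$2) + C * (p$3)\<^sup>2 * (v$2 * w$2)
     + D * p$3 * (v$1 * w$2 + v$2 * w$1))"

definition line_metric :: "real metric_tensor" where
  "line_metric = (\<lambda>p v w. v * w)"

definition form12 :: "real^3 \<Rightarrow> real^3 \<Rightarrow> real" where
  "form12 v w = - (v$1 * w$1) + v$2 * w$2 + v$3 * w$3"

definition form22 :: "real^4 \<Rightarrow> real^4 \<Rightarrow> real" where
  "form22 v w = - (v$1 * w$1) - v$2 * w$2 + v$3 * w$3 + v$4 * w$4"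

definition Min3 :: "(real^3) set" where "Min3 = UNIV"
definition Min3_metric :: "(real^3) metric_tensor" where "Min3_metric = (\<lambda>p. form12)"

(* The quadrics carry the metrics induced by the ambient forms; their constant sectional
   curvatures are 1 and -1. *)
definition dS2 :: "(real^3) set" where "dS2 = {p. form12 p p = 1}"
definition dS2_metric :: "(real^3) metric_tensor" where "dS2_metric = (\<lambda>p. form12)"

definition AdS3 :: "(real^4) set" where "AdS3 = {p. form22 p p = -1}"
definition AdS3_metric :: "(real^4) metric_tensor" where "AdS3_metric = (\<lambda>p. form22)"

record 'a lie_alg =
  lcarrier :: "'a set"
  ladd :: "'a \<Rightarrow> 'a \<Rightarrow> 'a"
  lscale :: "real \<Rightarrow> 'a \<Rightarrow> 'a"
  lbracket :: "'a \<Rightarrow> 'a \<Rightarrow> 'a"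

definition lie_hom :: "('a \<Rightarrow> 'b) \<Rightarrow> 'a lie_alg \<Rightarrow> 'b lie_alg \<Rightarrow> bool" where
  "lie_hom f L M \<longleftrightarrow>
     (\<forall>X\<in>lcarrier L. f X \<in> lcarrier M) \<and>
     (\<forall>X\<in>lcarrier L. \<forall>Y\<in>lcarrier L. f (ladd L X Y) = ladd M (f X) (f Y)) \<and>
     (\<forall>c. \<forall>X\<in>lcarrier L. f (lscale L c X) = lscale M c (f X)) \<and>
     (\<forall>X\<in>lcarrier L. \<forall>Y\<in>lcarrier L. f (lbracket L X Y) = lbracket M (f X) (f Y))"

definition lie_iso :: "('a \<Rightarrow> 'b) \<Rightarrow> 'a lie_alg \<Rightarrow> 'b lie_alg \<Rightarrow> bool" where
  "lie_iso f L M \<longleftrightarrow> lie_hom f L M \<and> bij_betw f (lcarrier L) (lcarrier M)"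

definition lie_isomorphic :: "'a lie_alg \<Rightarrow> 'b lie_alg \<Rightarrow> bool" where
  "lie_isomorphic L M \<longleftrightarrow> (\<exists>f. lie_iso f L M)"

definition lie_derivation :: "'a lie_alg \<Rightarrow> ('a \<Rightarrow> 'a) \<Rightarrow> bool" where
  "lie_derivation L d \<longleftrightarrow>
     (\<forall>X\<in>lcarrier L. d X \<in> lcarrier L) \<and>
     (\<forall>X\<in>lcarrier L. \<forall>Y\<in>lcarrier L. d (ladd L X Y) = ladd L (d X) (d Y)) \<and>
     (\<forall>c. \<forall>X\<in>lcarrier L. d (lscale L c X) = lscale L c (d X)) \<and>
     (\<forall>X\<in>lcarrier L. \<forall>Y\<in>lcarrier L.
        d (lbracket L X Y) = ladd L (lbracket L (d X) Y) (lbracket L X (d Y)))"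

definition lie_sum :: "'a lie_alg \<Rightarrow> 'b lie_alg \<Rightarrow> ('a \<times> 'b) lie_alg" where
  "lie_sum L M = \<lparr>
     lcarrier = lcarrier L \<times> lcarrier M,
     ladd = (\<lambda>p q. (ladd L (fst p) (fst q), ladd M (snd p) (snd q))),
     lscale = (\<lambda>c p. (lscale L c (fst p), lscale M c (snd p))),
     lbracket = (\<lambda>p q. (lbracket L (fst p) (fst q), lbracket M (snd p) (snd q)))\<rparr>"

(* The semidirect product of L with the ideal M; L acts on M by derivations through r:
   [(a, X), (b, Y)] = ([a, b], r a Y - r b X + [X, Y]). *)
definition lie_semidirect ::
  "'a lie_alg \<Rightarrow> 'b lie_alg \<Rightarrow> ('a \<Rightarrow> 'b \<Rightarrow> 'b) \<Rightarrow> ('a \<times> 'b) lie_alg" where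
  "lie_semidirect L M r = \<lparr>
     lcarrier = lcarrier L \<times> lcarrier M,
     ladd = (\<lambda>p q. (ladd L (fst p) (fst q), ladd M (snd p) (snd q))),
     lscale = (\<lambda>c p. (lscale L c (fst p), lscale M c (snd p))),
     lbracket = (\<lambda>p q. (lbracket L (fst p) (fst q),
        ladd M (ladd M (r (fst p) (snd q)) (lscale M (-1) (r (fst q) (snd p))))
               (lbracket M (snd p) (snd q))))\<rparr>"

definition abelian_lie :: "'a::real_vector lie_alg" where
  "abelian_lie = \<lparr>lcarrier = UNIV, ladd = (+), lscale = (*\<^sub>R), lbracket = (\<lambda>X Y. 0)\<rparr>"

definition matrix_lie :: "(real^'n^'n) set \<Rightarrow> (real^'n^'n) lie_alg" where
  "matrix_lie S = \<lparr>lcarrier = S, ladd = (+), lscale = (*\<^sub>R),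
     lbracket = (\<lambda>X Y. X ** Y - Y ** X)\<rparr>"

definition sl2 :: "(real^2^2) lie_alg" where
  "sl2 = matrix_lie {A. trace A = 0}"

(* Strictly upper triangular matrices.  The index type 3 is not ordered 1 < 2 < 3, hence
   the explicit entries. *)
definition heis_matrix :: "real \<Rightarrow> real \<Rightarrow> real \<Rightarrow> real^3^3" where
  "heis_matrix a b c = vector [vector [0, a, c], vector [0, 0, b], vector [0, 0, 0]]"

definition heis :: "(real^3^3) lie_alg" where
  "heis = matrix_lie {heis_matrix a b c |a b c. True}"

(* The irreducible representation of sl2 on R^3, that is, the adjoint representation in
   the coordinates v |-> [[v1, v2], [v3, -v1]] of sl2.  It preserves the Lorentzian form
   v1^2 + v2 v3 and identifies sl2 with so(1,2). *)
definition sl2_of_vec :: "real^3 \<Rightarrow> real^2^2" where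
  "sl2_of_vec v = vector [vector [v$1, v$2], vector [v$3, - v$1]]"

definition vec_of_sl2 :: "real^2^2 \<Rightarrow> real^3" where
  "vec_of_sl2 A = vector [A$1$1, A$1$2, A$2$1]"

definition sl2_act :: "real^2^2 \<Rightarrow> real^3 \<Rightarrow> real^3" where
  "sl2_act A v = vec_of_sl2 (A ** sl2_of_vec v - sl2_of_vec v ** A)"

definition semisimple_on :: "'a::real_vector set \<Rightarrow> ('a \<Rightarrow> 'a) \<Rightarrow> bool" where
  "semisimple_on V f \<longleftrightarrow>
     (\<forall>W. subspace W \<and> W \<subseteq> V \<and> f ` W \<subseteq> W \<longrightarrow>
        (\<exists>W'. subspace W' \<and> W' \<subseteq> V \<and> f ` W' \<subseteq> W' \<and>
              W \<inter> W' = {0} \<and> V = {a + b |a b. a \<in> W \<and> b \<in> W'}))"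

definition semisimple_sl2 :: "real^2^2 \<Rightarrow> bool" where
  "semisimple_sl2 s \<longleftrightarrow> s \<in> lcarrier sl2 \<and> s \<noteq> 0 \<and> semisimple_on UNIV ((*v) s)"

definition R_semisimple_sl2 :: "real^2^2 \<Rightarrow> bool" where
  "R_semisimple_sl2 s \<longleftrightarrow> s \<in> lcarrier sl2 \<and> s \<noteq> 0 \<and>
     (\<exists>P :: real^2^2. invertible P \<and> (\<forall>i j. i \<noteq> j \<longrightarrow> (matrix_inv P ** s ** P) $ i $ j = 0))"

definition SL2 :: "(real^2^2) set" where
  "SL2 = {A. det A = 1}"

definition Heis :: "(real^3^3) set" where
  "Heis = {mat 1 + X |X. X \<in> lcarrier heis}"

definition group_tangent :: "(real^'n^'n) lie_alg \<Rightarrow> real^'n^'n \<Rightarrow> (real^'n^'n) set" where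
  "group_tangent L A = (\<lambda>X. A ** X) ` lcarrier L"

(* G is a matrix Lie group with Lie algebra L.  By left invariance, smoothness of h on G
   is automatic. *)
definition left_invariant_metric ::
  "(real^'n^'n) set \<Rightarrow> (real^'n^'n) lie_alg \<Rightarrow> (real^'n^'n) metric_tensor \<Rightarrow> bool" where
  "left_invariant_metric G L h \<longleftrightarrow>
     (\<forall>A\<in>G. bilinear (h A) \<and>
        (\<forall>X\<in>group_tangent L A. \<forall>Y\<in>group_tangent L A. h A X Y = h A Y X) \<and>
        (\<forall>X\<in>group_tangent L A. (\<forall>Y\<in>group_tangent L A. h A X Y = 0) \<longrightarrow> X = 0)) \<and>
     (\<forall>A\<in>G. \<forall>B\<in>G. \<forall>X\<in>group_tangent L B. \<forall>Y\<in>group_tangent L B.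
        h (A ** B) (A ** X) (A ** Y) = h B X Y)"

definition lie_derivative_metric ::
  "('a::euclidean_space \<Rightarrow> 'a) \<Rightarrow> 'a metric_tensor \<Rightarrow> 'a metric_tensor" where
  "lie_derivative_metric X g = (\<lambda>p v w.
     frechet_derivative (\<lambda>q. g q v w) (at p) (X p)
     + g p (frechet_derivative X (at p) v) w
     + g p v (frechet_derivative X (at p) w))"

(* A vector field on U is represented by the function that extends it by 0 outside U, so
   that equality of fields is equality of functions. *)
definition killing_algebra ::
  "'a::euclidean_space metric_tensor \<Rightarrow> 'a set \<Rightarrow> ('a \<Rightarrow> 'a) lie_alg" where
  "killing_algebra g U = \<lparr>
     lcarrier = {X. smooth_on U X \<and> (\<forall>p. p \<notin> U \<longrightarrow> X p = 0) \<and>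
                    (\<forall>p\<in>U. \<forall>v w. lie_derivative_metric X g p v w = 0)},
     ladd = (\<lambda>X Y p. X p + Y p),
     lscale = (\<lambda>c X p. c *\<^sub>R X p),
     lbracket = (\<lambda>X Y p. if p \<in> U
        then frechet_derivative Y (at p) (X p) - frechet_derivative X (at p) (Y p) else 0)\<rparr>"

definition isotropy :: "'a::euclidean_space metric_tensor \<Rightarrow> 'a set \<Rightarrow> ('a \<Rightarrow> 'a) set" where
  "isotropy g U = {X \<in> lcarrier (killing_algebra g U). X 0 = 0}"

end

theory Submission
  imports Defs
begin

text \<open>Write a Killing field as \<open>a \<partial>\<^sub>x + b \<partial>\<^sub>h + c \<partial>\<^sub>z\<close>.  Differentiating the Killing equations shows that
  \<open>b\<close> does not depend on \<open>z\<close>, that \<open>C b\<^sub>x = b\<^sub>x\<^sub>h = 0\<close> and \<open>b\<^sub>x\<^sub>x = D b\<^sub>x\<close>, and that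
  \<open>c + z b\<^sub>h - (D/2) z\<^sup>2 b\<^sub>x\<close> is a function of \<open>x\<close> alone.  All solutions on a connected
  open set are therefore explicit: a four-parameter family of quadratic polynomials if \<open>C \<noteq> 0\<close>, and
  six-parameter families with exponentials (\<open>D \<noteq> 0\<close>) or affine (\<open>D = 0\<close>) if \<open>C = 0\<close>.
  The Lie algebras are read off from the brackets of these families.

  The local isometries are written down in coordinates.  If \<open>m = (D\<^sup>2 - C)/2 \<noteq> 0 \<noteq> D\<close>, three of the Killing
  fields span a simply transitive copy of \<open>sl(2)\<close>, which suggests the Gauss decomposition of \<open>SL(2)\<close>
  as a chart; for \<open>C = 0\<close> the same chart serves for anti-de Sitter space, identified with \<open>SL(2)\<close>.
  If \<open>C = D\<^sup>2\<close>, then \<open>g = (dx + D z dh)\<^sup>2 + 2 dh dz\<close> is visibly left-invariant on the Heisenberg group.\<close>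

subsection \<open>Smooth functions\<close>

text \<open>As \<open>U\<close> is merely connected, nothing is integrated along coordinate lines:
  each constant of integration is found as a function with zero gradient. The equations split
  because b_x, b_h, a_h and \<gamma> do not depend on z while the explicit coefficients are
  polynomials in z, so that differentiating in z separates the powers of z. In the quadratic family
  let R = h d_h - z d_z and let S be the member with s = 1 and all other parameters 0. Then [d_h, R]
  = d_h, [R, S] = S, [d_h, S] = -D d_x + K R with K = C - D^2, and d_x is central. If K is nonzero,
  then d_h, S and R - (D/K) d_x span sl(2), and R, which spans the isotropy, is an element of sl(2)
  plus the central field (D/K) d_x: hence a graph. If K = 0 and D is nonzero, then d_h, S, d_x span
  a Heisenberg algebra, on which R acts with weights -1, 1, 0. The scale factors 4/D^2 and 1/C
  reflect the curvatures -D^2/4 and C. The algebra isomorphisms are written from the model to the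
  fields, where they are formulas, and inverted afterwards.\<close>

lemma Ck_on_cong:
  assumes "open S" and "\<And>x. x \<in> S \<Longrightarrow> f x = g x"
  shows "Ck_on k f S \<longleftrightarrow> Ck_on k g S"
  using assms(2)
proof (induction k arbitrary: f g)
  case 0
  then show ?case
    by (simp cong: continuous_on_cong)
next
  case (Suc k)
  have hd: "(f has_derivative f') (at x) \<longleftrightarrow> (g has_derivative f') (at x)" if "x \<in> S" for x f'
    using has_derivative_transform_within_open[OF _ \<open>open S\<close> that] Suc.prems by metis
  \<comment> \<open>\<open>frechet_derivative\<close> is a choice among all derivatives, so the
    agreement of the predicates in \<open>hd\<close> also settles points without a
    derivative.\<close>
  then have fd: "frechet_derivative f (at x) = frechet_derivative g (at x)" if "x \<in> S" for x
    using that by (simp add: frechet_derivative_def)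
  have "Ck_on k (\<lambda>x. frechet_derivative f (at x) v) S = Ck_on k (\<lambda>x. frechet_derivative g (at x) v) S" for v
    by (rule Suc.IH) (simp add: fd)
  then show ?case
    using hd by (simp add: differentiable_def)
qed

text \<open>Lets an exhibited derivative replace the chosen \<open>frechet_derivative\<close>; the
  closure rules for sums, products and exponentials rest on this.\<close>

lemma Ck_on_Suc_iff:
  assumes "open S" and "\<And>x. x \<in> S \<Longrightarrow> (f has_derivative f' x) (at x)"
  shows "Ck_on (Suc k) f S \<longleftrightarrow> (\<forall>v. Ck_on k (\<lambda>x. f' x v) S)"
proof -
  have "Ck_on k (\<lambda>x. frechet_derivative f (at x) v) S = Ck_on k (\<lambda>x. f' x v) S" for v
    using frechet_derivative_at[OF assms(2)] by (intro Ck_on_cong[OF assms(1)]) auto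
  then show ?thesis
    using assms(2) by (auto simp: differentiable_def)
qed

lemma Ck_on_has_derivative:
  assumes "Ck_on (Suc k) f S" and "x \<in> S"
  shows "(f has_derivative frechet_derivative f (at x)) (at x)"
  using assms by (simp add: frechet_derivative_works)

lemma Ck_on_SucD: "Ck_on (Suc k) f S \<Longrightarrow> Ck_on k f S"
proof (induction k arbitrary: f)
  case 0
  then show ?case
    unfolding Ck_on.simps(1) by (intro differentiable_imp_continuous_on) (simp add: differentiable_at_imp_differentiable_on)
next
  case (Suc k)
  have "Ck_on k (\<lambda>x. frechet_derivative f (at x) v) S" for v
    using Suc.prems by (intro Suc.IH) (metis Ck_on.simps(2))
  then show ?case
    using Suc.prems by (metis Ck_on.simps(2))
qed

lemma Ck_on_const: "open S \<Longrightarrow> Ck_on k (\<lambda>x. c) S"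
proof (induction k arbitrary: c)
  case (Suc k)
  then show ?case
    by (subst Ck_on_Suc_iff[where f' = "\<lambda>_ _. 0"]) auto
qed simp

lemma Ck_on_linear:
  assumes "open S" and "bounded_linear L"
  shows "Ck_on k L S"
proof (cases k)
  case 0
  then show ?thesis
    using assms by (auto intro: linear_continuous_on)
next
  case (Suc j)
  then show ?thesis
    using assms
    by (subst Suc, subst Ck_on_Suc_iff[where f' = "\<lambda>_. L"])
       (auto intro: Ck_on_const bounded_linear_imp_has_derivative)
qed

lemma Ck_on_linear_compose:
  assumes "open S" and "bounded_linear L" and "Ck_on k f S"
  shows "Ck_on k (\<lambda>x. L (f x)) S"
  using assms(3)
proof (induction k arbitrary: f)
  case 0
  then show ?case
    using assms(2) by (simp add: bounded_linear.continuous_on)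
next
  case (Suc k)
  have "((\<lambda>x. L (f x)) has_derivative (\<lambda>v. L (frechet_derivative f (at x) v))) (at x)" if "x \<in> S" for x
    by (intro bounded_linear.has_derivative[OF assms(2)] Ck_on_has_derivative[OF Suc.prems that])
  then show ?case
    using Suc by (subst Ck_on_Suc_iff[OF assms(1)]) auto
qed

lemma Ck_on_add:
  assumes "open S" and "Ck_on k f S" and "Ck_on k g S"
  shows "Ck_on k (\<lambda>x. f x + g x) S"
  using assms(2,3)
proof (induction k arbitrary: f g)
  case 0
  then show ?case
    by (simp add: continuous_on_add)
next
  case (Suc k)
  have "((\<lambda>x. f x + g x) has_derivative
      (\<lambda>v. frechet_derivative f (at x) v + frechet_derivative g (at x) v)) (at x)" if "x \<in> S" for x
    using that Suc.prems by (intro has_derivative_add Ck_on_has_derivative)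
  then show ?case
    using Suc by (subst Ck_on_Suc_iff[OF assms(1)]) auto
qed

lemma Ck_on_scaleR:
  assumes "open S" and "Ck_on k f S" and "Ck_on k g S"
  shows "Ck_on k (\<lambda>x. f x *\<^sub>R g x) S"
  using assms(2,3)
proof (induction k arbitrary: f g)
  case 0
  then show ?case
    by (simp add: continuous_on_scaleR)
next
  case (Suc k)
  have "((\<lambda>x. f x *\<^sub>R g x) has_derivative
      (\<lambda>v. f x *\<^sub>R frechet_derivative g (at x) v + frechet_derivative f (at x) v *\<^sub>R g x)) (at x)"
    if "x \<in> S" for x
    using that Suc.prems by (intro has_derivative_scaleR Ck_on_has_derivative)
  \<comment> \<open>In the Leibniz rule an undifferentiated factor meets a derivative, so the former
    is first weakened from order \<open>Suc k\<close> to \<open>k\<close>.\<close>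
  moreover have "Ck_on k (\<lambda>x. f x *\<^sub>R frechet_derivative g (at x) v + frechet_derivative f (at x) v *\<^sub>R g x) S" for v
    using Suc.prems Ck_on_SucD[OF Suc.prems(1)] Ck_on_SucD[OF Suc.prems(2)]
    by (intro Ck_on_add[OF assms(1)] Suc.IH) auto
  ultimately show ?case
    by (subst Ck_on_Suc_iff[OF assms(1)]) auto
qed

text \<open>The derivative of exp f is exp f times f', so the induction returns to the same f one
  order lower and f can stay fixed.\<close>

lemma Ck_on_exp:
  fixes f :: "'a::euclidean_space \<Rightarrow> real"
  assumes "open S" and "Ck_on k f S"
  shows "Ck_on k (\<lambda>x. exp (f x)) S"
  using assms(2)
proof (induction k)
  case 0
  then show ?case
    by (simp add: continuous_on_exp)
next
  case (Suc k)
  have "((\<lambda>x. exp (f x)) has_derivative (\<lambda>v. exp (f x) *\<^sub>R frechet_derivative f (at x) v)) (at x)"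
    if "x \<in> S" for x
    using that Suc.prems by (auto intro!: derivative_eq_intros Ck_on_has_derivative)
  moreover have "Ck_on k (\<lambda>x. exp (f x) *\<^sub>R frechet_derivative f (at x) v) S" for v
    using Suc.prems Ck_on_SucD[OF Suc.prems] by (intro Ck_on_scaleR[OF assms(1)] Suc.IH) auto
  ultimately show ?case
    by (subst Ck_on_Suc_iff[OF assms(1)]) auto
qed

lemma smooth_on_const: "open S \<Longrightarrow> smooth_on S (\<lambda>x. c)"
  by (simp add: smooth_on_def Ck_on_const)

lemma smooth_on_linear: "open S \<Longrightarrow> bounded_linear L \<Longrightarrow> smooth_on S L"
  by (simp add: smooth_on_def Ck_on_linear)

lemma smooth_on_linear_compose:
  "open S \<Longrightarrow> bounded_linear L \<Longrightarrow> smooth_on S f \<Longrightarrow> smooth_on S (\<lambda>x. L (f x))"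
  by (simp add: smooth_on_def Ck_on_linear_compose)

lemma smooth_on_add:
  "open S \<Longrightarrow> smooth_on S f \<Longrightarrow> smooth_on S g \<Longrightarrow> smooth_on S (\<lambda>x. f x + g x)"
  by (simp add: smooth_on_def Ck_on_add)

lemma smooth_on_scaleR:
  "open S \<Longrightarrow> smooth_on S f \<Longrightarrow> smooth_on S g \<Longrightarrow> smooth_on S (\<lambda>x. f x *\<^sub>R g x)"
  by (simp add: smooth_on_def Ck_on_scaleR)

lemma smooth_on_mult:
  fixes f g :: "'a::euclidean_space \<Rightarrow> real"
  shows "open S \<Longrightarrow> smooth_on S f \<Longrightarrow> smooth_on S g \<Longrightarrow> smooth_on S (\<lambda>x. f x * g x)"
  using smooth_on_scaleR[of S f g] by simp

lemma smooth_on_minus: "open S \<Longrightarrow> smooth_on S f \<Longrightarrow> smooth_on S (\<lambda>x. - f x)"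
  by (rule smooth_on_linear_compose) (auto intro: bounded_linear_minus bounded_linear_ident)

lemma smooth_on_diff:
  "open S \<Longrightarrow> smooth_on S f \<Longrightarrow> smooth_on S g \<Longrightarrow> smooth_on S (\<lambda>x. f x - g x)"
  using smooth_on_add[of S f "\<lambda>x. - g x"] by (simp add: smooth_on_minus)

lemma smooth_on_power:
  fixes f :: "'a::euclidean_space \<Rightarrow> real"
  shows "open S \<Longrightarrow> smooth_on S f \<Longrightarrow> smooth_on S (\<lambda>x. f x ^ n)"
  by (induction n) (auto intro: smooth_on_const smooth_on_mult)

lemma smooth_on_exp:
  fixes f :: "'a::euclidean_space \<Rightarrow> real"
  shows "open S \<Longrightarrow> smooth_on S f \<Longrightarrow> smooth_on S (\<lambda>x. exp (f x))"
  by (simp add: smooth_on_def Ck_on_exp)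

lemma smooth_on_sum:
  "open S \<Longrightarrow> (\<And>i. i \<in> I \<Longrightarrow> smooth_on S (f i)) \<Longrightarrow> smooth_on S (\<lambda>x. \<Sum>i\<in>I. f i x)"
  by (induction I rule: infinite_finite_induct) (auto intro: smooth_on_const smooth_on_add)

lemma smooth_on_vec_nth:
  fixes f :: "'a::euclidean_space \<Rightarrow> 'b::real_normed_vector^'n"
  shows "open S \<Longrightarrow> smooth_on S f \<Longrightarrow> smooth_on S (\<lambda>x. f x $ i)"
  using smooth_on_linear_compose[OF _ bounded_linear_vec_nth] .

lemma smooth_on_nth: "open S \<Longrightarrow> smooth_on S (\<lambda>x :: real^'n. x $ i)"
  by (rule smooth_on_linear) (auto intro: bounded_linear_vec_nth)

lemma smooth_on_euclideanI:
  fixes f :: "'a::euclidean_space \<Rightarrow> 'b::euclidean_space"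
  assumes "open S" and "\<And>b. b \<in> Basis \<Longrightarrow> smooth_on S (\<lambda>x. f x \<bullet> b)"
  shows "smooth_on S f"
proof -
  have "smooth_on S (\<lambda>x. \<Sum>b\<in>Basis. (f x \<bullet> b) *\<^sub>R b)"
    using assms by (intro smooth_on_sum smooth_on_scaleR smooth_on_const) auto
  then show ?thesis
    by (simp add: euclidean_representation)
qed

lemma smooth_on_vecI:
  fixes f :: "'a::euclidean_space \<Rightarrow> 'b::euclidean_space^'n"
  assumes "open S" and "\<And>i. smooth_on S (\<lambda>x. f x $ i)"
  shows "smooth_on S f"
proof (rule smooth_on_euclideanI[OF assms(1)])
  fix b :: "'b^'n" assume "b \<in> Basis"
  then obtain i u where "b = axis i u"
    by (auto simp: Basis_vec_def)
  then show "smooth_on S (\<lambda>x. f x \<bullet> b)"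
    by (auto simp: inner_axis intro: smooth_on_linear_compose[OF assms(1) bounded_linear_inner_left assms(2)])
qed

lemma smooth_on_Pair:
  fixes f :: "'a::euclidean_space \<Rightarrow> 'b::real_normed_vector" and g :: "'a \<Rightarrow> 'c::real_normed_vector"
  assumes "open S" and "smooth_on S f" and "smooth_on S g"
  shows "smooth_on S (\<lambda>x. (f x, g x))"
proof -
  have "smooth_on S (\<lambda>x. (f x, 0::'c))" "smooth_on S (\<lambda>x. (0::'b, g x))"
    using smooth_on_linear_compose[OF assms(1) bounded_linear_Pair[OF bounded_linear_ident bounded_linear_zero] assms(2)]
      smooth_on_linear_compose[OF assms(1) bounded_linear_Pair[OF bounded_linear_zero bounded_linear_ident] assms(3)] .
  from smooth_on_add[OF assms(1) this] show ?thesis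
    by simp
qed

lemma smooth_on_cdivide:
  fixes f :: "'a::euclidean_space \<Rightarrow> real"
  shows "open S \<Longrightarrow> smooth_on S f \<Longrightarrow> smooth_on S (\<lambda>x. f x / c)"
  unfolding divide_inverse by (intro smooth_on_mult smooth_on_const)

lemmas smooth_on_intros = smooth_on_const smooth_on_nth smooth_on_add smooth_on_diff
  smooth_on_minus smooth_on_mult smooth_on_power smooth_on_exp smooth_on_cdivide

lemma Ck_on_subset: "Ck_on k f S \<Longrightarrow> T \<subseteq> S \<Longrightarrow> Ck_on k f T"
proof (induction k arbitrary: f)
  case 0
  then show ?case
    by (auto intro: continuous_on_subset)
next
  case (Suc k)
  then show ?case
    by (auto simp: subset_iff)
qed

lemma smooth_on_subset: "smooth_on S f \<Longrightarrow> T \<subseteq> S \<Longrightarrow> smooth_on T f"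
  unfolding smooth_on_def using Ck_on_subset by blast

lemma smooth_on_cong:
  "open S \<Longrightarrow> (\<And>x. x \<in> S \<Longrightarrow> f x = g x) \<Longrightarrow> smooth_on S f \<longleftrightarrow> smooth_on S g"
  by (simp add: smooth_on_def Ck_on_cong[of S f g])

lemma smooth_on_imp_continuous_on: "smooth_on S f \<Longrightarrow> continuous_on S f"
  unfolding smooth_on_def using Ck_on.simps(1) by blast

lemma smooth_on_has_derivative:
  "smooth_on S f \<Longrightarrow> x \<in> S \<Longrightarrow> (f has_derivative frechet_derivative f (at x)) (at x)"
  by (rule Ck_on_has_derivative[of 0]) (auto simp: smooth_on_def)

lemma smooth_on_frechet_derivative:
  "smooth_on S f \<Longrightarrow> smooth_on S (\<lambda>x. frechet_derivative f (at x) v)"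
  unfolding smooth_on_def using Ck_on.simps(2) by blast

section \<open>Symmetry of second derivatives\<close>

lemma second_difference_mean_value:
  fixes f :: "'a::euclidean_space \<Rightarrow> real"
  assumes "smooth_on S f" and "r > 0"
    and S: "\<And>s t. s \<in> {0..r} \<Longrightarrow> t \<in> {0..r} \<Longrightarrow> p + s *\<^sub>R u + t *\<^sub>R v \<in> S"
  obtains s t where "s \<in> {0..r}" "t \<in> {0..r}"
    "f (p + r *\<^sub>R u + r *\<^sub>R v) - f (p + r *\<^sub>R u) - f (p + r *\<^sub>R v) + f p =
      r\<^sup>2 * frechet_derivative (\<lambda>x. frechet_derivative f (at x) u) (at (p + s *\<^sub>R u + t *\<^sub>R v)) v"
proof -
  define fu where "fu = (\<lambda>x. frechet_derivative f (at x) u)"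
  have lin: "linear (frechet_derivative f (at x))" "linear (frechet_derivative fu (at x))" if "x \<in> S" for x
    using smooth_on_has_derivative[OF assms(1) that] that
      smooth_on_has_derivative[OF smooth_on_frechet_derivative[OF assms(1)] that]
    by (auto simp: fu_def dest: has_derivative_linear)
  have d1: "((\<lambda>s. f (p + s *\<^sub>R u + t *\<^sub>R v)) has_real_derivative fu (p + s *\<^sub>R u + t *\<^sub>R v)) (at s)"
    if "s \<in> {0..r}" "t \<in> {0..r}" for s t
  proof -
    have "((\<lambda>s. f (p + s *\<^sub>R u + t *\<^sub>R v)) has_derivative
        (\<lambda>h. frechet_derivative f (at (p + s *\<^sub>R u + t *\<^sub>R v)) (h *\<^sub>R u))) (at s)"
      by (rule has_derivative_compose[where f = "\<lambda>s. p + s *\<^sub>R u + t *\<^sub>R v",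
            OF _ smooth_on_has_derivative[OF assms(1) S[OF that]]]) (auto intro!: derivative_eq_intros)
    also have "(\<lambda>h. frechet_derivative f (at (p + s *\<^sub>R u + t *\<^sub>R v)) (h *\<^sub>R u)) =
        (*) (fu (p + s *\<^sub>R u + t *\<^sub>R v))"
      using linear_cmul[OF lin(1)[OF S[OF that]]] by (simp add: fu_def fun_eq_iff)
    finally show ?thesis
      by (simp add: has_field_derivative_def)
  qed
  have d2: "((\<lambda>t. fu (p + s *\<^sub>R u + t *\<^sub>R v)) has_real_derivative
      frechet_derivative fu (at (p + s *\<^sub>R u + t *\<^sub>R v)) v) (at t)"
    if "s \<in> {0..r}" "t \<in> {0..r}" for s t
  proof -
    have "((\<lambda>t. fu (p + s *\<^sub>R u + t *\<^sub>R v)) has_derivative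
        (\<lambda>h. frechet_derivative fu (at (p + s *\<^sub>R u + t *\<^sub>R v)) (h *\<^sub>R v))) (at t)"
      unfolding fu_def
      by (rule has_derivative_compose[where f = "\<lambda>t. p + s *\<^sub>R u + t *\<^sub>R v",
            OF _ smooth_on_has_derivative[OF smooth_on_frechet_derivative[OF assms(1)] S[OF that]]])
         (auto intro!: derivative_eq_intros)
    also have "(\<lambda>h. frechet_derivative fu (at (p + s *\<^sub>R u + t *\<^sub>R v)) (h *\<^sub>R v)) =
        (*) (frechet_derivative fu (at (p + s *\<^sub>R u + t *\<^sub>R v)) v)"
      using linear_cmul[OF lin(2)[OF S[OF that]]] by (simp add: fun_eq_iff)
    finally show ?thesis
      by (simp add: has_field_derivative_def)
  qed
  \<comment> \<open>Mean value theorem in s for f(p + s u + r v) - f(p + s u). The multiples by 0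
    stay visible so that \<open>d1\<close> applies as it stands. A second application, in t, then
    handles the derivative along u.\<close>
  have "\<exists>s. 0 < s \<and> s < r \<and> (f (p + r *\<^sub>R u + r *\<^sub>R v) - f (p + r *\<^sub>R u + 0 *\<^sub>R v)) -
      (f (p + 0 *\<^sub>R u + r *\<^sub>R v) - f (p + 0 *\<^sub>R u + 0 *\<^sub>R v)) =
      (r - 0) * (fu (p + s *\<^sub>R u + r *\<^sub>R v) - fu (p + s *\<^sub>R u + 0 *\<^sub>R v))"
    using \<open>r > 0\<close> by (intro MVT2 DERIV_diff d1) auto
  then obtain s where s: "0 < s" "s < r" and eq1:
    "f (p + r *\<^sub>R u + r *\<^sub>R v) - f (p + r *\<^sub>R u) - f (p + r *\<^sub>R v) + f p =
      r * (fu (p + s *\<^sub>R u + r *\<^sub>R v) - fu (p + s *\<^sub>R u + 0 *\<^sub>R v))"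
    by auto
  have "\<exists>t. 0 < t \<and> t < r \<and> fu (p + s *\<^sub>R u + r *\<^sub>R v) - fu (p + s *\<^sub>R u + 0 *\<^sub>R v) =
      (r - 0) * frechet_derivative fu (at (p + s *\<^sub>R u + t *\<^sub>R v)) v"
    using \<open>r > 0\<close> s by (intro MVT2 d2) auto
  then obtain t where t: "0 < t" "t < r" and eq2:
    "fu (p + s *\<^sub>R u + r *\<^sub>R v) - fu (p + s *\<^sub>R u + 0 *\<^sub>R v) =
      r * frechet_derivative fu (at (p + s *\<^sub>R u + t *\<^sub>R v)) v"
    by auto
  show thesis
    using s t eq1 unfolding eq2 by (intro that[of s t]) (auto simp: power2_eq_square fu_def)
qed

text \<open>The second difference is symmetric in u and v, so the two mixed derivatives take a
  common value at points arbitrarily close to p; by continuity they agree at p.\<close>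

lemma smooth_on_frechet_derivative_commute:
  fixes f :: "'a::euclidean_space \<Rightarrow> real"
  assumes "open S" and "smooth_on S f" and "p \<in> S"
  shows "frechet_derivative (\<lambda>x. frechet_derivative f (at x) u) (at p) v =
         frechet_derivative (\<lambda>x. frechet_derivative f (at x) v) (at p) u"
proof (rule ccontr)
  define F where "F = (\<lambda>u v q. frechet_derivative (\<lambda>x. frechet_derivative f (at x) u) (at q) v)"
  assume "\<not> ?thesis"
  then have ne: "F u v p \<noteq> F v u p"
    by (simp add: F_def)
  \<comment> \<open>Half the supposed gap: two values within less than e of the two sides cannot
    coincide.\<close>
  define e where "e = \<bar>F u v p - F v u p\<bar> / 2"
  have "e > 0"
    using ne by (simp add: e_def)
  have "isCont (F u v) p" "isCont (F v u) p"
    using smooth_on_imp_continuous_on[OF smooth_on_frechet_derivative[OF smooth_on_frechet_derivative[OF assms(2)]]]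
      assms(1,3) by (auto simp: F_def continuous_on_eq_continuous_at)
  then have "\<forall>\<^sub>F q in nhds p. dist (F u v q) (F u v p) < e \<and> dist (F v u q) (F v u p) < e \<and> q \<in> S"
    using \<open>e > 0\<close> assms(1,3)
    by (intro eventually_conj tendstoD) (auto simp: isCont_def tendsto_at_iff_tendsto_nhds eventually_nhds_in_open)
  then obtain d where "d > 0" and d: "\<And>q. dist q p < d \<Longrightarrow> dist (F u v q) (F u v p) < e"
    "\<And>q. dist q p < d \<Longrightarrow> dist (F v u q) (F v u p) < e" "\<And>q. dist q p < d \<Longrightarrow> q \<in> S"
    by (auto simp: eventually_nhds_metric)
  \<comment> \<open>The summand 1 keeps N positive when u = v = 0; then r N = d/2 keeps the whole
    parallelogram inside the ball of radius d.\<close>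
  define N where "N = norm u + norm v + 1"
  define r where "r = d / N / 2"
  have pos: "N > 0"
    unfolding N_def by (smt (verit) norm_ge_zero)
  have "r > 0"
    using \<open>d > 0\<close> pos by (simp add: r_def)
  have near: "dist (p + s *\<^sub>R a + t *\<^sub>R b) p < d" if "s \<in> {0..r}" "t \<in> {0..r}" "norm a + norm b = norm u + norm v"
    for s t a b
  proof -
    have "norm (s *\<^sub>R a + t *\<^sub>R b) \<le> s * norm a + t * norm b"
      using that by (intro norm_triangle_le) auto
    also have "\<dots> \<le> r * norm a + r * norm b"
      using that by (intro add_mono mult_right_mono) auto
    also have "\<dots> = r * (norm u + norm v)"
      using that(3) by (simp flip: distrib_left)
    also have "\<dots> < r * N"
      using \<open>r > 0\<close> by (simp add: N_def)
    also have "\<dots> = d / 2"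
      using pos by (simp add: r_def)
    finally show ?thesis
      using \<open>d > 0\<close> by (simp add: dist_norm add.assoc)
  qed
  obtain s t where st: "s \<in> {0..r}" "t \<in> {0..r}"
    "f (p + r *\<^sub>R u + r *\<^sub>R v) - f (p + r *\<^sub>R u) - f (p + r *\<^sub>R v) + f p =
      r\<^sup>2 * F u v (p + s *\<^sub>R u + t *\<^sub>R v)"
    unfolding F_def
    by (rule second_difference_mean_value[OF assms(2) \<open>r > 0\<close>, of p u v]) (auto intro!: d(3) near)
  obtain s' t' where st': "s' \<in> {0..r}" "t' \<in> {0..r}"
    "f (p + r *\<^sub>R v + r *\<^sub>R u) - f (p + r *\<^sub>R v) - f (p + r *\<^sub>R u) + f p =
      r\<^sup>2 * F v u (p + s' *\<^sub>R v + t' *\<^sub>R u)"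
    unfolding F_def
    by (rule second_difference_mean_value[OF assms(2) \<open>r > 0\<close>, of p v u]) (auto intro!: d(3) near)
  have "r\<^sup>2 * F u v (p + s *\<^sub>R u + t *\<^sub>R v) = r\<^sup>2 * F v u (p + s' *\<^sub>R v + t' *\<^sub>R u)"
    unfolding st(3)[symmetric] st'(3)[symmetric] by (simp add: algebra_simps)
  then have "F u v (p + s *\<^sub>R u + t *\<^sub>R v) = F v u (p + s' *\<^sub>R v + t' *\<^sub>R u)"
    using \<open>r > 0\<close> by simp
  moreover have "\<bar>F u v (p + s *\<^sub>R u + t *\<^sub>R v) - F u v p\<bar> < e"
    using d(1)[OF near[OF st(1,2)]] by (simp add: dist_real_def)
  moreover have "\<bar>F v u (p + s' *\<^sub>R v + t' *\<^sub>R u) - F v u p\<bar> < e"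
    using d(2)[OF near[OF st'(1,2)]] by (simp add: dist_real_def add.commute)
  moreover have "\<bar>F u v p - F v u p\<bar> = 2 * e"
    by (simp add: e_def)
  ultimately show False
    by linarith
qed

subsection \<open>Partial derivatives\<close>

definition pd :: "'n \<Rightarrow> (real^'n \<Rightarrow> real) \<Rightarrow> real^'n \<Rightarrow> real" where
  "pd i f = (\<lambda>p. frechet_derivative f (at p) (axis i 1))"

lemma pd_eq: "(f has_derivative f') (at p) \<Longrightarrow> pd i f p = f' (axis i 1)"
  by (simp add: pd_def frechet_derivative_at[symmetric])

lemma smooth_on_pd: "smooth_on S f \<Longrightarrow> smooth_on S (pd i f)"
  unfolding pd_def by (rule smooth_on_frechet_derivative)

lemma smooth_on_differentiable: "smooth_on S f \<Longrightarrow> p \<in> S \<Longrightarrow> f differentiable (at p)"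
  using smooth_on_has_derivative differentiable_def by blast

lemma pd_commute:
  "open S \<Longrightarrow> smooth_on S f \<Longrightarrow> p \<in> S \<Longrightarrow> pd i (pd j f) p = pd j (pd i f) p"
  unfolding pd_def by (rule smooth_on_frechet_derivative_commute)

lemma pd_cong:
  assumes "open S" and "\<And>q. q \<in> S \<Longrightarrow> f q = g q" and "p \<in> S"
  shows "pd i f p = pd i g p"
proof -
  have "(f has_derivative f') (at p) \<longleftrightarrow> (g has_derivative f') (at p)" for f'
    using has_derivative_transform_within_open[OF _ assms(1,3)] assms(2) by metis
  then show ?thesis
    by (simp add: pd_def frechet_derivative_def)
qed

lemma pd_const: "pd i (\<lambda>q. k) p = 0"
  by (subst pd_eq) auto

lemma pd_nth: "pd i (\<lambda>q. q $ j) p = (if i = j then 1 else 0)"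
  by (simp add: pd_eq[OF bounded_linear_imp_has_derivative[OF bounded_linear_vec_nth]] axis_def)

lemma pd_add:
  "f differentiable (at p) \<Longrightarrow> g differentiable (at p) \<Longrightarrow>
    pd i (\<lambda>q. f q + g q) p = pd i f p + pd i g p"
  unfolding frechet_derivative_works by (subst pd_eq, erule (1) has_derivative_add) (simp add: pd_def)

lemma pd_minus: "f differentiable (at p) \<Longrightarrow> pd i (\<lambda>q. - f q) p = - pd i f p"
  unfolding frechet_derivative_works by (subst pd_eq, erule has_derivative_minus) (simp add: pd_def)

lemma pd_diff:
  "f differentiable (at p) \<Longrightarrow> g differentiable (at p) \<Longrightarrow>
    pd i (\<lambda>q. f q - g q) p = pd i f p - pd i g p"
  unfolding frechet_derivative_works by (subst pd_eq, erule (1) has_derivative_diff) (simp add: pd_def)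

lemma pd_mult:
  "f differentiable (at p) \<Longrightarrow> g differentiable (at p) \<Longrightarrow>
    pd i (\<lambda>q. f q * g q) p = f p * pd i g p + pd i f p * g p"
  unfolding frechet_derivative_works by (subst pd_eq, erule (1) has_derivative_mult) (simp add: pd_def)

lemma pd_power2:
  "f differentiable (at p) \<Longrightarrow> pd i (\<lambda>q. (f q)\<^sup>2) p = 2 * f p * pd i f p"
  by (simp add: power2_eq_square pd_mult)

lemma pd_exp:
  "f differentiable (at p) \<Longrightarrow> pd i (\<lambda>q. exp (f q)) p = exp (f p) * pd i f p"
  unfolding frechet_derivative_works by (subst pd_eq, erule has_derivative_exp) (simp add: pd_def)

lemma pd_cdivide:
  "f differentiable (at p) \<Longrightarrow> pd i (\<lambda>q. f q / k) p = pd i f p / k"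
  using pd_mult[of f p "\<lambda>_. inverse k" i] by (simp add: pd_const divide_inverse)

lemma differentiable_cdivide:
  fixes f :: "'a::real_normed_vector \<Rightarrow> real"
  shows "f differentiable (at p) \<Longrightarrow> (\<lambda>q. f q / k) differentiable (at p)"
  unfolding divide_inverse by (intro differentiable_mult differentiable_const)

lemma differentiable_vec_nth: "(\<lambda>q. q $ i) differentiable (at (p :: real^'n))"
  by (rule bounded_linear_imp_differentiable) (rule bounded_linear_vec_nth)

lemma differentiable_exp:
  fixes f :: "'a::real_normed_vector \<Rightarrow> real"
  shows "f differentiable (at p) \<Longrightarrow> (\<lambda>q. exp (f q)) differentiable (at p)"
  unfolding differentiable_def using has_derivative_exp by blast

lemmas pd_simps = pd_const pd_nth pd_add pd_minus pd_diff pd_mult pd_power2 pd_exp pd_cdivide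

lemmas pd_differentiable = differentiable_const differentiable_vec_nth differentiable_add
  differentiable_minus differentiable_diff differentiable_mult differentiable_power differentiable_exp
  differentiable_cdivide

lemma frechet_derivative_pd:
  fixes f :: "real^'n \<Rightarrow> real"
  assumes "f differentiable (at p)"
  shows "frechet_derivative f (at p) v = (\<Sum>i\<in>UNIV. v $ i * pd i f p)"
proof -
  have l: "linear (frechet_derivative f (at p))"
    using assms by (rule linear_frechet_derivative)
  have "frechet_derivative f (at p) v = frechet_derivative f (at p) (\<Sum>i\<in>UNIV. v $ i *\<^sub>R axis i 1)"
    by (simp add: basis_expansion[of v] scalar_mult_eq_scaleR[symmetric])
  also have "\<dots> = (\<Sum>i\<in>UNIV. v $ i * pd i f p)"
    by (simp add: linear_sum[OF l] linear_cmul[OF l] pd_def)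
  finally show ?thesis .
qed

lemma constant_if_pd_zero:
  fixes f :: "real^'n \<Rightarrow> real"
  assumes "open U" and "connected U"
    and "\<And>p. p \<in> U \<Longrightarrow> f differentiable (at p)" and "\<And>p i. p \<in> U \<Longrightarrow> pd i f p = 0"
  obtains k where "\<And>p. p \<in> U \<Longrightarrow> f p = k"
proof -
  have "(f has_derivative (\<lambda>v. 0)) (at p)" if "p \<in> U" for p
  proof -
    have "(f has_derivative frechet_derivative f (at p)) (at p)"
      using assms(3)[OF that] by (simp add: frechet_derivative_works)
    also have "frechet_derivative f (at p) = (\<lambda>v. 0)"
      using frechet_derivative_pd[OF assms(3)[OF that]] assms(4)[OF that] by (simp add: fun_eq_iff)
    finally show ?thesis .
  qed
  from has_derivative_zero_unique_connected[OF assms(1,2) this]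
  have "f p = f q" if "p \<in> U" "q \<in> U" for p q
    using that by blast
  then show thesis
    by (metis that)
qed

subsection \<open>The Killing equations\<close>

text \<open>The functions a, b, c are the components along x, h, z. Equation \<open>eij\<close> is
  the coefficient of the coordinate pair i, j in the Lie derivative of the metric, halved when i =
  j.\<close>

locale killing_system =
  fixes U :: "(real^3) set" and a b c :: "real^3 \<Rightarrow> real" and C D :: real
  assumes open_U: "open U" and connected_U: "connected U"
    and smooth: "smooth_on U a" "smooth_on U b" "smooth_on U c"
    and e11: "p \<in> U \<Longrightarrow> pd 1 a p + D * p$3 * pd 1 b p = 0"
    and e13: "p \<in> U \<Longrightarrow> pd 1 b p + pd 3 a p + D * p$3 * pd 3 b p = 0"
    and e33: "p \<in> U \<Longrightarrow> pd 3 b p = 0"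
    and e23: "p \<in> U \<Longrightarrow> pd 2 b p + D * p$3 * pd 3 a p + C * (p$3)\<^sup>2 * pd 3 b p + pd 3 c p = 0"
    and e12: "p \<in> U \<Longrightarrow> D * c p + D * p$3 * pd 1 a p + C * (p$3)\<^sup>2 * pd 1 b p + pd 1 c p
                 + pd 2 a p + D * p$3 * pd 2 b p = 0"
    and e22: "p \<in> U \<Longrightarrow> C * p$3 * c p + D * p$3 * pd 2 a p + C * (p$3)\<^sup>2 * pd 2 b p + pd 2 c p = 0"
begin

lemmas commute = pd_commute[OF open_U]
lemmas cong = pd_cong[OF open_U]
lemmas diffs = smooth_on_differentiable[where S = U]
lemmas sm = smooth smooth_on_pd

section \<open>Differential consequences of the six equations\<close>

lemma b_z: "p \<in> U \<Longrightarrow> pd i (pd 3 b) p = 0" "p \<in> U \<Longrightarrow> pd 3 (pd i b) p = 0"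
proof -
  show 1: "p \<in> U \<Longrightarrow> pd i (pd 3 b) p = 0"
    using cong[of "pd 3 b" "\<lambda>_. 0" p i] e33 by (simp add: pd_simps)
  show "p \<in> U \<Longrightarrow> pd 3 (pd i b) p = 0"
    using 1 commute sm by simp
qed

lemma a_z: "p \<in> U \<Longrightarrow> pd 3 a p = - pd 1 b p"
  using e13[of p] e33[of p] by simp

lemma a_x: "p \<in> U \<Longrightarrow> pd 1 a p = - (D * p$3 * pd 1 b p)"
  using e11[of p] by simp

lemma c_z: "p \<in> U \<Longrightarrow> pd 3 c p = - pd 2 b p + D * p$3 * pd 1 b p"
  using e23[of p] e33[of p] a_z[of p] by simp

lemma pd_a_z: "p \<in> U \<Longrightarrow> pd i (pd 3 a) p = - pd i (pd 1 b) p"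
  using cong[OF a_z, where p = p and i = i] by (simp add: pd_simps pd_differentiable sm diffs)

lemma pd_a_x: "p \<in> U \<Longrightarrow> pd i (pd 1 a) p =
    - (D * ((if i = 3 then 1 else 0) * pd 1 b p + p$3 * pd i (pd 1 b) p))"
  using cong[OF a_x, where p = p and i = i] by (simp add: pd_simps pd_differentiable sm diffs algebra_simps)

lemma pd_c_z: "p \<in> U \<Longrightarrow> pd i (pd 3 c) p = - pd i (pd 2 b) p +
    D * ((if i = 3 then 1 else 0) * pd 1 b p + p$3 * pd i (pd 1 b) p)"
  using cong[OF c_z, where p = p and i = i] by (simp add: pd_simps pd_differentiable sm diffs algebra_simps)

text \<open>Compare the mixed derivative of a in x and z computed from a_z = -b_x with the one
  computed from a_x = -D z b_x, using that b_x is independent of z.\<close>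

lemma b_xx: "p \<in> U \<Longrightarrow> pd 1 (pd 1 b) p = D * pd 1 b p"
  using pd_a_z[of p 1] pd_a_x[of p 3] commute[OF smooth(1), of p 1 3] b_z[of p 1] by simp

text \<open>The z-derivative of \<open>e12\<close>, with every second derivative of a and c
  expressed by b; the terms in D cancel and 2 C z b_x - 2 b_xh = 0 remains.\<close>

lemma b_xh_aux:
  assumes "p \<in> U"
  shows "pd 2 (pd 1 b) p = C * p$3 * pd 1 b p"
proof -
  have "pd 3 (\<lambda>p. D * c p + D * p$3 * pd 1 a p + C * (p$3)\<^sup>2 * pd 1 b p + pd 1 c p
                 + pd 2 a p + D * p$3 * pd 2 b p) p = 0"
    using cong[OF e12 assms, where i = 3] by (simp add: pd_const)
  then have "D * pd 3 c p + D * pd 1 a p + D * p$3 * pd 3 (pd 1 a) p + 2 * C * p$3 * pd 1 b p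
      + pd 3 (pd 1 c) p + pd 3 (pd 2 a) p + D * pd 2 b p = 0"
    using assms by (simp add: pd_simps pd_differentiable sm diffs b_z algebra_simps)
  then have *: "D * (- pd 2 b p + D * p$3 * pd 1 b p) - D * (D * p$3 * pd 1 b p)
      - D * p$3 * (D * pd 1 b p) + 2 * C * p$3 * pd 1 b p
      + (- pd 1 (pd 2 b) p + D * (p$3 * (D * pd 1 b p))) - pd 2 (pd 1 b) p + D * pd 2 b p = 0"
    using assms
    by (simp add: commute[OF smooth(1), of p 3 2] commute[OF smooth(3), of p 3 1]
        pd_a_z pd_c_z pd_a_x b_xx b_z a_x c_z)
  show ?thesis
    using * commute[OF smooth(2) assms, of 1 2] by (simp add: algebra_simps)
qed

text \<open>In b_xh = C z b_x the left side and b_x are independent of z, so the z-derivative leaves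
  0 = C b_x.\<close>

lemma C_b_x: assumes "p \<in> U" shows "C * pd 1 b p = 0"
proof -
  have "pd 3 (pd 2 (pd 1 b)) p = pd 3 (\<lambda>p. C * p$3 * pd 1 b p) p"
    using cong[OF b_xh_aux assms] .
  also have "\<dots> = C * pd 1 b p"
    using assms by (simp add: pd_simps pd_differentiable sm diffs b_z)
  also have "pd 3 (pd 2 (pd 1 b)) p = pd 2 (pd 3 (pd 1 b)) p"
    using assms by (intro commute sm)
  also have "\<dots> = 0"
    using cong[OF b_z(2) assms] by (simp add: pd_const)
  finally show ?thesis
    by simp
qed

lemma b_xh: "p \<in> U \<Longrightarrow> pd 2 (pd 1 b) p = 0" "p \<in> U \<Longrightarrow> pd 1 (pd 2 b) p = 0"
  using b_xh_aux[of p] C_b_x[of p] commute[OF smooth(2), of p 1 2] by auto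

text \<open>By \<open>c_z\<close>, c differs from \<gamma> by an explicit primitive in z of -b_h + D
  z b_x; what is left does not depend on z.\<close>

definition \<gamma> :: "real^3 \<Rightarrow> real" where
  "\<gamma> p = c p + p$3 * pd 2 b p - D / 2 * (p$3)\<^sup>2 * pd 1 b p"

lemma smooth_\<gamma>: "smooth_on U \<gamma>"
  unfolding \<gamma>_def by (intro smooth_on_intros open_U sm)

lemma pd_\<gamma>:
  "p \<in> U \<Longrightarrow> pd i \<gamma> p = pd i c p + p$3 * pd i (pd 2 b) p + (if i = 3 then 1 else 0) * pd 2 b p
    - D * p$3 * (if i = 3 then 1 else 0) * pd 1 b p - D / 2 * (p$3)\<^sup>2 * pd i (pd 1 b) p"
  unfolding \<gamma>_def by (simp add: pd_simps pd_differentiable sm diffs add_divide_distrib)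

lemma \<gamma>_z: "p \<in> U \<Longrightarrow> pd 3 \<gamma> p = 0"
  by (simp add: pd_\<gamma> c_z b_z)

lemma pd_\<gamma>_z: "p \<in> U \<Longrightarrow> pd 3 (pd i \<gamma>) p = 0"
  using cong[OF \<gamma>_z, where p = p and i = i] commute[OF smooth_\<gamma>, of p 3 i] by (simp add: pd_const)

lemma \<gamma>_x: "p \<in> U \<Longrightarrow> pd 1 \<gamma> p = - D * \<gamma> p - pd 2 a p"
  \<comment> \<open>Either C or b_x vanishes; each case removes the term C z^2 b_x.\<close>
  using e12[of p] C_b_x[of p]
  by (cases "C = 0") (simp_all add: pd_\<gamma> \<gamma>_def a_x b_xx b_xh power2_eq_square field_simps)

lemma \<gamma>_e22: "p \<in> U \<Longrightarrow> C * p$3 * \<gamma> p + D * p$3 * pd 2 a p + pd 2 \<gamma> p - p$3 * pd 2 (pd 2 b) p = 0"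
  using e22[of p] C_b_x[of p]
  by (cases "C = 0") (simp_all add: pd_\<gamma> \<gamma>_def b_xh power2_eq_square field_simps)

lemma a_hz: "p \<in> U \<Longrightarrow> pd 3 (pd 2 a) p = 0"
  using commute[OF smooth(1), of p 3 2] by (simp add: pd_a_z b_xh)

lemma a_hx: "p \<in> U \<Longrightarrow> pd 1 (pd 2 a) p = 0"
  using commute[OF smooth(1), of p 1 2] by (simp add: pd_a_x b_xh)

lemma b_hhz: "p \<in> U \<Longrightarrow> pd 3 (pd 2 (pd 2 b)) p = 0"
  using commute[of "pd 2 b" p 3 2] cong[OF b_z(2), where p = p and i = 2] by (simp add: pd_const sm)

text \<open>\<open>\<gamma>_e22\<close> is affine in z, with coefficients independent of z. Its
  z-derivative is the linear coefficient, which must vanish; the constant term then gives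
  \<open>\<gamma>_h\<close>.\<close>

lemma b_hh: assumes "p \<in> U" shows "pd 2 (pd 2 b) p = C * \<gamma> p + D * pd 2 a p"
proof -
  have "pd 3 (\<lambda>p. C * p$3 * \<gamma> p + D * p$3 * pd 2 a p + pd 2 \<gamma> p - p$3 * pd 2 (pd 2 b) p) p = 0"
    using cong[OF \<gamma>_e22 assms, where i = 3] by (simp add: pd_const)
  then show ?thesis
    using assms by (simp add: pd_simps pd_differentiable sm smooth_\<gamma> diffs \<gamma>_z pd_\<gamma>_z a_hz b_hhz)
qed

lemma \<gamma>_h: "p \<in> U \<Longrightarrow> pd 2 \<gamma> p = 0"
  using \<gamma>_e22[of p] by (simp add: b_hh algebra_simps)

text \<open>Differentiate \<open>\<gamma>_x\<close> in h: both terms with \<gamma> vanish because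
  \<gamma>_h = 0.\<close>

lemma a_hh: assumes "p \<in> U" shows "pd 2 (pd 2 a) p = 0"
proof -
  have "pd 2 (pd 1 \<gamma>) p = - D * pd 2 \<gamma> p - pd 2 (pd 2 a) p"
    using cong[OF \<gamma>_x assms, where i = 2] assms
    by (simp add: pd_simps pd_differentiable sm smooth_\<gamma> diffs)
  moreover have "pd 2 (pd 1 \<gamma>) p = 0"
    using commute[OF smooth_\<gamma> assms, of 2 1] cong[OF \<gamma>_h assms, where i = 1] by (simp add: pd_const)
  ultimately show ?thesis
    using assms by (simp add: \<gamma>_h)
qed

text \<open>In the x-derivative of \<open>b_hh\<close> both b_hhx and a_hx vanish, so only C
  \<gamma>_x survives.\<close>

lemma C_\<gamma>_x: assumes "p \<in> U" shows "C * pd 1 \<gamma> p = 0"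
proof -
  have "pd 1 (pd 2 (pd 2 b)) p = C * pd 1 \<gamma> p"
    using cong[OF b_hh assms, where i = 1] assms
    by (simp add: pd_simps pd_differentiable sm smooth_\<gamma> diffs a_hx)
  moreover have "pd 1 (pd 2 (pd 2 b)) p = 0"
    using commute[of "pd 2 b" p 1 2] cong[OF b_xh(2) assms, where i = 2] assms by (simp add: pd_const sm)
  ultimately show ?thesis
    by simp
qed

section \<open>Integration of the system\<close>

lemma constantE:
  assumes "\<And>p. p \<in> U \<Longrightarrow> f differentiable (at p)"
    and "\<And>p. p \<in> U \<Longrightarrow> pd 1 f p = 0" "\<And>p. p \<in> U \<Longrightarrow> pd 2 f p = 0" "\<And>p. p \<in> U \<Longrightarrow> pd 3 f p = 0"
  obtains k where "\<And>p. p \<in> U \<Longrightarrow> f p = k"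
proof -
  have "pd i f p = 0" if "p \<in> U" for p i
    using exhaust_3[of i] assms(2-4)[OF that] by auto
  from constant_if_pd_zero[OF open_U connected_U assms(1) this] that show thesis
    by metis
qed

text \<open>The part of the integration common to all C and D. The functions \<gamma> and b are left
  open: only their derivatives are recorded, because their shape depends on whether C and D
  vanish.\<close>

definition general_form :: "real \<Rightarrow> real \<Rightarrow> real \<Rightarrow> real \<Rightarrow> real \<Rightarrow> bool" where
  "general_form a0 \<alpha> \<beta> b1 \<kappa> \<longleftrightarrow>
    (\<forall>p\<in>U. a p = a0 + \<alpha> * p$2 - p$3 * (\<beta> * exp (D * p$1)) \<and>
      c p = \<gamma> p - p$3 * (b1 + \<kappa> * p$2) + D / 2 * (p$3)\<^sup>2 * (\<beta> * exp (D * p$1)) \<and>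
      pd 1 b p = \<beta> * exp (D * p$1) \<and>
      pd 2 b p = b1 + \<kappa> * p$2 \<and>
      \<kappa> = C * \<gamma> p + D * \<alpha> \<and>
      pd 1 \<gamma> p = - D * \<gamma> p - \<alpha> \<and>
      C * \<beta> = 0)"

lemma general_solution: "\<exists>a0 \<alpha> \<beta> b1 \<kappa>. general_form a0 \<alpha> \<beta> b1 \<kappa>"
proof -
  obtain \<alpha> where \<alpha>: "\<And>p. p \<in> U \<Longrightarrow> pd 2 a p = \<alpha>"
    by (rule constantE[of "pd 2 a"]) (auto simp: a_hx a_hh a_hz sm diffs)
  \<comment> \<open>By \<open>b_hh\<close> this constant is the second h-derivative of b, which
    makes b_h affine in h.\<close>
  obtain \<kappa> where \<kappa>: "\<And>p. p \<in> U \<Longrightarrow> C * \<gamma> p + D * \<alpha> = \<kappa>"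
    by (rule constantE[of "\<lambda>p. C * \<gamma> p + D * \<alpha>"])
      (auto simp: pd_simps pd_differentiable sm smooth_\<gamma> diffs C_\<gamma>_x \<gamma>_h \<gamma>_z)
  obtain a0 where a0: "\<And>p. p \<in> U \<Longrightarrow> a p + p$3 * pd 1 b p - \<alpha> * p$2 = a0"
    by (rule constantE[of "\<lambda>p. a p + p$3 * pd 1 b p - \<alpha> * p$2"])
      (auto simp: pd_simps pd_differentiable sm diffs \<alpha> a_x a_z b_xx b_xh b_z)
  \<comment> \<open>The exponential is the integrating factor of b_xx = D b_x.\<close>
  obtain \<beta> where \<beta>: "\<And>p. p \<in> U \<Longrightarrow> pd 1 b p * exp (- (D * p$1)) = \<beta>"
    by (rule constantE[of "\<lambda>p. pd 1 b p * exp (- (D * p$1))"])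
      (auto simp: pd_simps pd_differentiable sm diffs b_xx b_xh b_z)
  obtain b1 where b1: "\<And>p. p \<in> U \<Longrightarrow> pd 2 b p - \<kappa> * p$2 = b1"
    by (rule constantE[of "\<lambda>p. pd 2 b p - \<kappa> * p$2"])
      (auto simp: pd_simps pd_differentiable sm diffs b_hh b_xh b_z \<alpha> \<kappa>)
  have \<beta>': "pd 1 b p = \<beta> * exp (D * p$1)" if "p \<in> U" for p
    using \<beta>[OF that, symmetric] by (simp add: mult.assoc flip: exp_add)
  have b1': "pd 2 b p = b1 + \<kappa> * p$2" if "p \<in> U" for p
    using b1[OF that] by simp
  have "C * \<beta> = 0" if "p \<in> U" for p
    using C_b_x[OF that] \<beta>'[OF that] by simp
  then have "general_form a0 \<alpha> \<beta> b1 \<kappa>"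
    using a0 \<alpha> \<kappa> \<beta>' b1' \<gamma>_x by (auto simp: general_form_def \<gamma>_def algebra_simps)
  then show ?thesis
    by blast
qed

lemma general_formD:
  assumes "general_form a0 \<alpha> \<beta> b1 \<kappa>" and "p \<in> U"
  shows "a p = a0 + \<alpha> * p$2 - p$3 * (\<beta> * exp (D * p$1))"
    "c p = \<gamma> p - p$3 * (b1 + \<kappa> * p$2) + D / 2 * (p$3)\<^sup>2 * (\<beta> * exp (D * p$1))"
    "pd 1 b p = \<beta> * exp (D * p$1)"
    "pd 2 b p = b1 + \<kappa> * p$2"
    "\<kappa> = C * \<gamma> p + D * \<alpha>"
    "pd 1 \<gamma> p = - D * \<gamma> p - \<alpha>"
    "C * \<beta> = 0"
  using assms unfolding general_form_def by blast+

text \<open>For nonzero C the relations C \<beta> = 0 and C \<gamma>_x = 0 kill \<beta> and make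
  \<gamma> a constant \<gamma>0; the equation for \<gamma>_x then becomes \<alpha> = -D \<gamma>0,
  which leaves four parameters.\<close>

lemma solution_C_nonzero:
  assumes "C \<noteq> 0"
  obtains a0 b0 b1 \<gamma>0 where
    "\<And>p. p \<in> U \<Longrightarrow> a p = a0 - D * \<gamma>0 * p$2"
    "\<And>p. p \<in> U \<Longrightarrow> b p = b0 + b1 * p$2 + (C - D\<^sup>2) / 2 * \<gamma>0 * (p$2)\<^sup>2"
    "\<And>p. p \<in> U \<Longrightarrow> c p = \<gamma>0 - p$3 * (b1 + (C - D\<^sup>2) * \<gamma>0 * p$2)"
\<comment> \<open>The relations between the constants are stated at points of U, so they are
  extracted with the help of one such point.\<close>
proof (cases "U = {}")
  case False
  obtain a0 \<alpha> \<beta> b1 \<kappa> where "general_form a0 \<alpha> \<beta> b1 \<kappa>"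
    using general_solution by blast
  note gs = general_formD[OF this]
  have [simp]: "\<beta> = 0"
    using gs(7) False assms by (metis ex_in_conv mult_eq_0_iff)
  obtain \<gamma>0 where \<gamma>0: "\<And>p. p \<in> U \<Longrightarrow> \<gamma> p = \<gamma>0"
    by (rule constantE[of \<gamma>]) (use assms C_\<gamma>_x in \<open>auto simp: smooth_\<gamma> diffs \<gamma>_h \<gamma>_z\<close>)
  have \<alpha>: "\<alpha> = - D * \<gamma>0"
    using False gs(6) C_\<gamma>_x assms \<gamma>0 by fastforce
  have \<kappa>: "\<kappa> = (C - D\<^sup>2) * \<gamma>0"
    using False gs(5) \<alpha> \<gamma>0 by (fastforce simp: algebra_simps power2_eq_square)
  obtain b0 where b0: "\<And>p. p \<in> U \<Longrightarrow> b p - b1 * p$2 - \<kappa> / 2 * (p$2)\<^sup>2 = b0"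
    by (rule constantE[of "\<lambda>p. b p - b1 * p$2 - \<kappa> / 2 * (p$2)\<^sup>2"])
      (auto simp: pd_simps pd_differentiable sm diffs gs e33)
  show thesis
  proof (rule that)
    show "b p = b0 + b1 * p$2 + (C - D\<^sup>2) / 2 * \<gamma>0 * (p$2)\<^sup>2" if "p \<in> U" for p
      using b0[OF that] \<kappa> by simp
  qed (simp_all add: gs(1,2) \<alpha> \<kappa> \<gamma>0)
qed simp

text \<open>With C = 0 the constant \<beta> survives, and \<gamma>_x = -D \<gamma> - \<alpha> is
  solved by -\<alpha>/D plus a multiple of exp(-D x): two parameters more than for nonzero
  C.\<close>

lemma solution_C_zero:
  assumes "C = 0" and "D \<noteq> 0"
  obtains a0 b0 b1 \<alpha> \<beta> \<delta> where
    "\<And>p. p \<in> U \<Longrightarrow> a p = a0 + \<alpha> * p$2 - D * \<beta> * p$3 * exp (D * p$1)"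
    "\<And>p. p \<in> U \<Longrightarrow> b p = b0 + b1 * p$2 + D * \<alpha> / 2 * (p$2)\<^sup>2 + \<beta> * exp (D * p$1)"
    "\<And>p. p \<in> U \<Longrightarrow> c p = - \<alpha> / D - p$3 * (b1 + D * \<alpha> * p$2)
        + D\<^sup>2 * \<beta> / 2 * (p$3)\<^sup>2 * exp (D * p$1) + \<delta> * exp (- (D * p$1))"
proof (cases "U = {}")
  case False
  obtain a0 \<alpha> \<beta> b1 \<kappa> where "general_form a0 \<alpha> \<beta> b1 \<kappa>"
    using general_solution by blast
  note gs = general_formD[OF this]
  have \<kappa>: "\<kappa> = D * \<alpha>"
    using False gs(5) assms by auto
  obtain \<delta> where \<delta>: "\<And>p. p \<in> U \<Longrightarrow> (\<gamma> p + \<alpha> / D) * exp (D * p$1) = \<delta>"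
    by (rule constantE[of "\<lambda>p. (\<gamma> p + \<alpha> / D) * exp (D * p$1)"])
      (use assms in \<open>auto simp: pd_simps pd_differentiable sm smooth_\<gamma> diffs gs \<gamma>_h \<gamma>_z field_simps\<close>)
  have \<gamma>': "\<gamma> p = - \<alpha> / D + \<delta> * exp (- (D * p$1))" if "p \<in> U" for p
    using \<delta>[OF that, symmetric] by (simp add: mult.assoc flip: exp_add)
  obtain b0 where b0: "\<And>p. p \<in> U \<Longrightarrow> b p - b1 * p$2 - \<kappa> / 2 * (p$2)\<^sup>2 - \<beta> / D * exp (D * p$1) = b0"
    by (rule constantE[of "\<lambda>p. b p - b1 * p$2 - \<kappa> / 2 * (p$2)\<^sup>2 - \<beta> / D * exp (D * p$1)"])
      (use assms in \<open>auto simp: pd_simps pd_differentiable sm diffs gs e33\<close>)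
  show thesis
  \<comment> \<open>The witness for \<beta> is \<beta>/D, the factor left when b_x = \<beta> exp(D
    x) is integrated.\<close>
  proof (rule that)
    show "a p = a0 + \<alpha> * p$2 - D * (\<beta> / D) * p$3 * exp (D * p$1)" if "p \<in> U" for p
      using that assms by (simp add: gs)
    show "b p = b0 + b1 * p$2 + D * \<alpha> / 2 * (p$2)\<^sup>2 + \<beta> / D * exp (D * p$1)" if "p \<in> U" for p
      using b0[OF that] \<kappa> by simp
    show "c p = - \<alpha> / D - p$3 * (b1 + D * \<alpha> * p$2)
        + D\<^sup>2 * (\<beta> / D) / 2 * (p$3)\<^sup>2 * exp (D * p$1) + \<delta> * exp (- (D * p$1))" if "p \<in> U" for p
      using that assms by (simp add: gs(2) \<gamma>' \<kappa> power2_eq_square)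
  qed
qed simp

lemma solution_flat:
  assumes "C = 0" and "D = 0"
  obtains a0 b0 c0 \<alpha> \<beta> b1 where
    "\<And>p. p \<in> U \<Longrightarrow> a p = a0 + \<alpha> * p$2 - \<beta> * p$3"
    "\<And>p. p \<in> U \<Longrightarrow> b p = b0 + b1 * p$2 + \<beta> * p$1"
    "\<And>p. p \<in> U \<Longrightarrow> c p = c0 - b1 * p$3 - \<alpha> * p$1"
proof (cases "U = {}")
  case False
  obtain a0 \<alpha> \<beta> b1 \<kappa> where "general_form a0 \<alpha> \<beta> b1 \<kappa>"
    using general_solution by blast
  note gs = general_formD[OF this]
  have \<kappa>: "\<kappa> = 0"
    using False gs(5) assms by auto
  have \<gamma>_x': "pd 1 \<gamma> p = - \<alpha>" if "p \<in> U" for p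
    using gs(6)[OF that] assms by simp
  obtain c0 where c0: "\<And>p. p \<in> U \<Longrightarrow> \<gamma> p + \<alpha> * p$1 = c0"
    by (rule constantE[of "\<lambda>p. \<gamma> p + \<alpha> * p$1"])
      (auto simp: pd_simps pd_differentiable sm smooth_\<gamma> diffs \<gamma>_x' \<gamma>_h \<gamma>_z)
  obtain b0 where b0: "\<And>p. p \<in> U \<Longrightarrow> b p - b1 * p$2 - \<beta> * p$1 = b0"
    by (rule constantE[of "\<lambda>p. b p - b1 * p$2 - \<beta> * p$1"])
      (use assms \<kappa> in \<open>auto simp: pd_simps pd_differentiable sm diffs gs e33\<close>)
  show thesis
  proof (rule that)
    show "b p = b0 + b1 * p$2 + \<beta> * p$1" if "p \<in> U" for p
      using b0[OF that] by simp
    show "c p = c0 - b1 * p$3 - \<alpha> * p$1" if "p \<in> U" for p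
      using c0[OF that] gs(2)[OF that] assms \<kappa> by simp
  qed (simp add: gs(1) assms)
qed simp

end

section \<open>The Killing condition in components\<close>

lemma frechet_derivative_vec_nth:
  fixes X :: "real^'n \<Rightarrow> real^'m"
  assumes "X differentiable (at p)"
  shows "frechet_derivative X (at p) v $ j = (\<Sum>i\<in>UNIV. v $ i * pd i (\<lambda>q. X q $ j) p)"
proof -
  have *: "((\<lambda>q. X q $ j) has_derivative (\<lambda>v. frechet_derivative X (at p) v $ j)) (at p)"
    using assms by (intro bounded_linear.has_derivative[OF bounded_linear_vec_nth])
      (simp add: frechet_derivative_works)
  then have "(\<lambda>q. X q $ j) differentiable (at p)"
    by (auto simp: differentiable_def)
  from frechet_derivative_pd[OF this, of v] show ?thesis
    by (simp add: frechet_derivative_at[OF *, symmetric])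
qed

lemma lie_derivative_g_CD:
  assumes "X differentiable (at p)"
  defines "a \<equiv> \<lambda>q. X q $ 1" and "b \<equiv> \<lambda>q. X q $ 2" and "c \<equiv> \<lambda>q. X q $ 3"
  shows "lie_derivative_metric X (g_CD C D) p v w =
    2 * (pd 1 a p + D * p$3 * pd 1 b p) * (v$1 * w$1)
    + (pd 1 b p + pd 3 a p + D * p$3 * pd 3 b p) * (v$1 * w$3 + v$3 * w$1)
    + 2 * pd 3 b p * (v$3 * w$3)
    + (pd 2 b p + D * p$3 * pd 3 a p + C * (p$3)\<^sup>2 * pd 3 b p + pd 3 c p) * (v$2 * w$3 + v$3 * w$2)
    + (D * c p + D * p$3 * pd 1 a p + C * (p$3)\<^sup>2 * pd 1 b p + pd 1 c p + pd 2 a p + D * p$3 * pd 2 b p)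
      * (v$1 * w$2 + v$2 * w$1)
    + 2 * (C * p$3 * c p + D * p$3 * pd 2 a p + C * (p$3)\<^sup>2 * pd 2 b p + pd 2 c p) * (v$2 * w$2)"
proof -
  have "((\<lambda>q. g_CD C D q v w) has_derivative
      (\<lambda>u. C * (2 * p$3 * u$3) * (v$2 * w$2) + D * u$3 * (v$1 * w$2 + v$2 * w$1))) (at p)"
    unfolding g_CD_def
    by (auto intro!: derivative_eq_intros bounded_linear_imp_has_derivative bounded_linear_vec_nth)
  note d = frechet_derivative_at[OF this, symmetric]
  show ?thesis
    unfolding lie_derivative_metric_def d
    by (simp add: g_CD_def frechet_derivative_vec_nth[OF assms(1)] sum_3 a_def b_def c_def
        power2_eq_square algebra_simps)
qed

lemma killing_algebra_g_CD_iff: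
  assumes "open U" and "connected U"
  shows "X \<in> lcarrier (killing_algebra (g_CD C D) U) \<longleftrightarrow>
    (\<forall>p. p \<notin> U \<longrightarrow> X p = 0) \<and> killing_system U (\<lambda>p. X p $ 1) (\<lambda>p. X p $ 2) (\<lambda>p. X p $ 3) C D"
    (is "?L \<longleftrightarrow> ?R")
proof
  assume L: ?L
  then have s: "smooth_on U X"
    and l: "\<And>p v w. p \<in> U \<Longrightarrow> lie_derivative_metric X (g_CD C D) p v w = 0"
    by (auto simp: killing_algebra_def)
  have "killing_system U (\<lambda>p. X p $ 1) (\<lambda>p. X p $ 2) (\<lambda>p. X p $ 3) C D"
  proof
    fix p assume p: "p \<in> U"
    \<comment> \<open>Pairs of coordinate vectors isolate the six coefficients of the symmetric
      form.\<close>
    note l' = l[OF p, unfolded lie_derivative_g_CD[OF smooth_on_differentiable[OF s p]]]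
    show "pd 1 (\<lambda>p. X p $ 1) p + D * p$3 * pd 1 (\<lambda>p. X p $ 2) p = 0"
      using l'[of "axis 1 1" "axis 1 1"] by (simp add: axis_def)
    show "pd 1 (\<lambda>p. X p $ 2) p + pd 3 (\<lambda>p. X p $ 1) p + D * p$3 * pd 3 (\<lambda>p. X p $ 2) p = 0"
      using l'[of "axis 1 1" "axis 3 1"] by (simp add: axis_def)
    show "pd 3 (\<lambda>p. X p $ 2) p = 0"
      using l'[of "axis 3 1" "axis 3 1"] by (simp add: axis_def)
    show "pd 2 (\<lambda>p. X p $ 2) p + D * p$3 * pd 3 (\<lambda>p. X p $ 1) p +
        C * (p$3)\<^sup>2 * pd 3 (\<lambda>p. X p $ 2) p + pd 3 (\<lambda>p. X p $ 3) p = 0"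
      using l'[of "axis 2 1" "axis 3 1"] by (simp add: axis_def)
    show "D * X p $ 3 + D * p$3 * pd 1 (\<lambda>p. X p $ 1) p + C * (p$3)\<^sup>2 * pd 1 (\<lambda>p. X p $ 2) p +
        pd 1 (\<lambda>p. X p $ 3) p + pd 2 (\<lambda>p. X p $ 1) p + D * p$3 * pd 2 (\<lambda>p. X p $ 2) p = 0"
      using l'[of "axis 1 1" "axis 2 1"] by (simp add: axis_def)
    show "C * p$3 * X p $ 3 + D * p$3 * pd 2 (\<lambda>p. X p $ 1) p +
        C * (p$3)\<^sup>2 * pd 2 (\<lambda>p. X p $ 2) p + pd 2 (\<lambda>p. X p $ 3) p = 0"
      using l'[of "axis 2 1" "axis 2 1"] by (simp add: axis_def)
  qed (use assms s in \<open>auto intro: smooth_on_vec_nth\<close>)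
  with L show ?R
    by (auto simp: killing_algebra_def)
next
  assume R: ?R
  then interpret killing_system U "\<lambda>p. X p $ 1" "\<lambda>p. X p $ 2" "\<lambda>p. X p $ 3" C D
    by simp
  have s: "smooth_on U X"
    using smooth by (intro smooth_on_vecI[OF assms(1)]) (metis exhaust_3)
  have "lie_derivative_metric X (g_CD C D) p v w = 0" if "p \<in> U" for p v w
    unfolding lie_derivative_g_CD[OF smooth_on_differentiable[OF s that]]
    \<comment> \<open>\<open>e33\<close> waits for a second pass: as a rewrite rule it would erase
      the terms by which \<open>e13\<close> and \<open>e23\<close> are recognised.\<close>
    using that by (simp only: e11 e13 e23 e12 e22) (simp add: e33)
  with R s show ?L
    by (simp add: killing_algebra_def)
qed

section \<open>Fields given by components, and their brackets\<close>

definition vec_field :: "(real^3) set \<Rightarrow> (real^3 \<Rightarrow> real) \<Rightarrow> (real^3 \<Rightarrow> real) \<Rightarrow> (real^3 \<Rightarrow> real) \<Rightarrow> real^3 \<Rightarrow> real^3" where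
  "vec_field U a b c = (\<lambda>p. if p \<in> U then vector [a p, b p, c p] else 0)"

lemma vec_field_nth:
  "p \<in> U \<Longrightarrow> vec_field U a b c p $ 1 = a p"
  "p \<in> U \<Longrightarrow> vec_field U a b c p $ 2 = b p"
  "p \<in> U \<Longrightarrow> vec_field U a b c p $ 3 = c p"
  by (simp_all add: vec_field_def)

lemma vec_field_eqI:
  assumes "\<And>p. p \<notin> U \<Longrightarrow> X p = 0"
    and "\<And>p. p \<in> U \<Longrightarrow> X p $ 1 = a p" "\<And>p. p \<in> U \<Longrightarrow> X p $ 2 = b p" "\<And>p. p \<in> U \<Longrightarrow> X p $ 3 = c p"
  shows "X = vec_field U a b c"
  using assms by (auto simp: vec_field_def fun_eq_iff vec_eq_iff forall_3)

lemma vec_field_in_killing_algebra: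
  assumes "killing_system U a b c C D"
  shows "vec_field U a b c \<in> lcarrier (killing_algebra (g_CD C D) U)"
proof -
  interpret killing_system U a b c C D
    by fact
  have n: "pd i (\<lambda>p. vec_field U a b c p $ 1) p = pd i a p" "pd i (\<lambda>p. vec_field U a b c p $ 2) p = pd i b p"
    "pd i (\<lambda>p. vec_field U a b c p $ 3) p = pd i c p" if "p \<in> U" for p i
    using that by (auto intro!: cong simp: vec_field_nth)
  have s: "smooth_on U (\<lambda>p. vec_field U a b c p $ 1)" "smooth_on U (\<lambda>p. vec_field U a b c p $ 2)"
    "smooth_on U (\<lambda>p. vec_field U a b c p $ 3)"
    using smooth by (simp_all add: smooth_on_cong[OF open_U vec_field_nth(1)]
        smooth_on_cong[OF open_U vec_field_nth(2)] smooth_on_cong[OF open_U vec_field_nth(3)])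
  have "killing_system U (\<lambda>p. vec_field U a b c p $ 1) (\<lambda>p. vec_field U a b c p $ 2) (\<lambda>p. vec_field U a b c p $ 3) C D"
    by unfold_locales
      (simp_all only: n vec_field_nth s open_U connected_U, (erule e11 e13 e33 e23 e12 e22)+)
  then show ?thesis
    by (simp add: killing_algebra_g_CD_iff[OF open_U connected_U] vec_field_def)
qed

lemma killing_algebra_ops:
  "ladd (killing_algebra g U) = (\<lambda>X Y p. X p + Y p)"
  "lscale (killing_algebra g U) = (\<lambda>c X p. c *\<^sub>R X p)"
  by (simp_all add: killing_algebra_def)

lemma ladd_vec_field:
  "ladd (killing_algebra g U) (vec_field U a b c) (vec_field U a' b' c') =
    vec_field U (\<lambda>p. a p + a' p) (\<lambda>p. b p + b' p) (\<lambda>p. c p + c' p)"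
  by (auto simp: killing_algebra_ops vec_field_def fun_eq_iff vec_eq_iff forall_3)

lemma lscale_vec_field:
  "lscale (killing_algebra g U) k (vec_field U a b c) =
    vec_field U (\<lambda>p. k * a p) (\<lambda>p. k * b p) (\<lambda>p. k * c p)"
  by (auto simp: killing_algebra_ops vec_field_def fun_eq_iff vec_eq_iff forall_3)

lemma lbracket_vec_field:
  assumes "open U" and "smooth_on U a" "smooth_on U b" "smooth_on U c"
    and "smooth_on U a'" "smooth_on U b'" "smooth_on U c'"
  defines "ad \<equiv> \<lambda>f f' p. (a p * pd 1 f' p + b p * pd 2 f' p + c p * pd 3 f' p)
    - (a' p * pd 1 f p + b' p * pd 2 f p + c' p * pd 3 f p)"
  shows "lbracket (killing_algebra g U) (vec_field U a b c) (vec_field U a' b' c') =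
    vec_field U (ad a a') (ad b b') (ad c c')"
proof -
  have s: "smooth_on U (vec_field U u v w)" if "smooth_on U u" "smooth_on U v" "smooth_on U w" for u v w
  proof -
    have "smooth_on U (\<lambda>p. vec_field U u v w p $ i)" for i
      using exhaust_3[of i] that by (auto simp: smooth_on_cong[OF assms(1) vec_field_nth(1)]
        smooth_on_cong[OF assms(1) vec_field_nth(2)] smooth_on_cong[OF assms(1) vec_field_nth(3)])
    then show ?thesis
      by (intro smooth_on_vecI assms(1))
  qed
  have n: "pd i (\<lambda>p. vec_field U u v w p $ 1) p = pd i u p" "pd i (\<lambda>p. vec_field U u v w p $ 2) p = pd i v p"
    "pd i (\<lambda>p. vec_field U u v w p $ 3) p = pd i w p" if "p \<in> U" for p i u v w
    using that by (auto intro!: pd_cong[OF assms(1)] simp: vec_field_nth)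
  show ?thesis
    by (rule vec_field_eqI)
      (auto simp: killing_algebra_def frechet_derivative_vec_nth smooth_on_differentiable[OF s] assms(2-7)
        sum_3 vec_field_nth n ad_def algebra_simps)
qed

text \<open>Reverses the explicit maps, which run from a model algebra to Killing fields. Closure of
  the model under its operations is what lets the inverse cancel on a sum or a bracket.\<close>

lemma lie_iso_inv_into:
  assumes "lie_iso f L M"
    and add: "\<And>x y. x \<in> lcarrier L \<Longrightarrow> y \<in> lcarrier L \<Longrightarrow> ladd L x y \<in> lcarrier L"
    and scale: "\<And>c x. x \<in> lcarrier L \<Longrightarrow> lscale L c x \<in> lcarrier L"
    and bracket: "\<And>x y. x \<in> lcarrier L \<Longrightarrow> y \<in> lcarrier L \<Longrightarrow> lbracket L x y \<in> lcarrier L"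
  shows "lie_iso (inv_into (lcarrier L) f) M L"
proof -
  let ?g = "inv_into (lcarrier L) f"
  have h: "lie_hom f L M" and b: "bij_betw f (lcarrier L) (lcarrier M)"
    using assms(1) by (auto simp: lie_iso_def)
  have g: "?g X \<in> lcarrier L" "f (?g X) = X" if "X \<in> lcarrier M" for X
    using b that by (auto simp: bij_betw_def inv_into_into f_inv_into_f)
  have inv: "?g (f x) = x" if "x \<in> lcarrier L" for x
    using b that by (auto simp: bij_betw_def)
  have "?g (ladd M X Y) = ladd L (?g X) (?g Y)" "?g (lbracket M X Y) = lbracket L (?g X) (?g Y)"
    if "X \<in> lcarrier M" "Y \<in> lcarrier M" for X Y
    using h inv[OF add[OF g(1)[OF that(1)] g(1)[OF that(2)]]]
      inv[OF bracket[OF g(1)[OF that(1)] g(1)[OF that(2)]]] that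
    by (auto simp: lie_hom_def g)
  moreover have "?g (lscale M c X) = lscale L c (?g X)" if "X \<in> lcarrier M" for X c
    using h inv[OF scale[OF g(1)[OF that]]] that by (auto simp: lie_hom_def g)
  ultimately have "lie_hom ?g M L"
    using g by (simp add: lie_hom_def)
  then show ?thesis
    using b by (simp add: lie_iso_def bij_betw_inv_into)
qed

lemma inv_into_image_Collect:
  assumes "bij_betw f A B"
  shows "inv_into A f ` {y \<in> B. P y} = {x \<in> A. P (f x)}"
proof (intro equalityI subsetI)
  fix x assume "x \<in> {x \<in> A. P (f x)}"
  then show "x \<in> inv_into A f ` {y \<in> B. P y}"
    using assms by (auto simp: bij_betw_def intro!: image_eqI[of _ _ "f x"])
next
  fix x assume "x \<in> inv_into A f ` {y \<in> B. P y}"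
  then show "x \<in> {x \<in> A. P (f x)}"
    using assms by (auto simp: bij_betw_def inv_into_into f_inv_into_f)
qed

section \<open>The quadratic family, all Killing fields for nonzero C\<close>

definition quadratic_field :: "real \<Rightarrow> real \<Rightarrow> (real^3) set \<Rightarrow> real \<Rightarrow> real \<Rightarrow> real \<Rightarrow> real \<Rightarrow> real^3 \<Rightarrow> real^3" where
  "quadratic_field C D U k l r s = vec_field U
    (\<lambda>p. k - D * s * p$2)
    (\<lambda>p. l + r * p$2 + (C - D\<^sup>2) / 2 * s * (p$2)\<^sup>2)
    (\<lambda>p. s - p$3 * (r + (C - D\<^sup>2) * s * p$2))"

lemma killing_system_quadratic:
  assumes "open U" and "connected U"
  shows "killing_system U
    (\<lambda>p. k - D * s * p$2)
    (\<lambda>p. l + r * p$2 + (C - D\<^sup>2) / 2 * s * (p$2)\<^sup>2)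
    (\<lambda>p. s - p$3 * (r + (C - D\<^sup>2) * s * p$2)) C D"
  by unfold_locales
    (intro smooth_on_intros assms | simp add: assms pd_simps pd_differentiable power2_eq_square field_simps)+

lemma quadratic_field_in_killing_algebra:
  "open U \<Longrightarrow> connected U \<Longrightarrow> quadratic_field C D U k l r s \<in> lcarrier (killing_algebra (g_CD C D) U)"
  unfolding quadratic_field_def by (intro vec_field_in_killing_algebra killing_system_quadratic)

lemma killing_algebra_quadratic:
  assumes "open U" and "connected U" and "C \<noteq> 0" and "X \<in> lcarrier (killing_algebra (g_CD C D) U)"
  obtains k l r s where "X = quadratic_field C D U k l r s"
proof -
  interpret killing_system U "\<lambda>p. X p $ 1" "\<lambda>p. X p $ 2" "\<lambda>p. X p $ 3" C D
    using assms by (simp add: killing_algebra_g_CD_iff)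
  have z: "p \<notin> U \<Longrightarrow> X p = 0" for p
    using assms by (simp add: killing_algebra_g_CD_iff)
  show thesis
  proof (rule solution_C_nonzero[OF assms(3)])
    fix k l r s
    assume "\<And>p. p \<in> U \<Longrightarrow> X p $ 1 = k - D * s * p $ 2"
      "\<And>p. p \<in> U \<Longrightarrow> X p $ 2 = l + r * p $ 2 + (C - D\<^sup>2) / 2 * s * (p $ 2)\<^sup>2"
      "\<And>p. p \<in> U \<Longrightarrow> X p $ 3 = s - p $ 3 * (r + (C - D\<^sup>2) * s * p $ 2)"
    from vec_field_eqI[OF z this] show thesis
      by (intro that) (simp add: quadratic_field_def)
  qed
qed

lemma ladd_quadratic_field:
  "ladd (killing_algebra g U) (quadratic_field C D U k l r s) (quadratic_field C D U k' l' r' s') =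
    quadratic_field C D U (k + k') (l + l') (r + r') (s + s')"
  by (simp add: quadratic_field_def ladd_vec_field algebra_simps add_divide_distrib diff_divide_distrib)

lemma lscale_quadratic_field:
  "lscale (killing_algebra g U) c (quadratic_field C D U k l r s) =
    quadratic_field C D U (c * k) (c * l) (c * r) (c * s)"
  by (simp add: quadratic_field_def lscale_vec_field algebra_simps)

text \<open>The parameters k and k' never enter, so d_x is central. Only l s' - s l' reaches the
  first and third parameters; whether C - D^2 vanishes decides between sl(2) and Heisenberg.\<close>

lemma lbracket_quadratic_field:
  assumes "open U"
  shows "lbracket (killing_algebra g U) (quadratic_field C D U k l r s) (quadratic_field C D U k' l' r' s') =
    quadratic_field C D U (- D * (l * s' - s * l')) (l * r' - r * l')
      ((C - D\<^sup>2) * (l * s' - s * l')) (r * s' - s * r')"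
  unfolding quadratic_field_def
  by (subst lbracket_vec_field[OF assms]; (intro smooth_on_intros assms)?)
    (auto simp: vec_field_def fun_eq_iff vec_eq_iff forall_3 pd_simps pd_differentiable power2_eq_square field_simps)

lemma quadratic_field_inject:
  assumes "open U" and "0 \<in> U"
  shows "quadratic_field C D U k l r s = quadratic_field C D U k' l' r' s' \<longleftrightarrow>
    k = k' \<and> l = l' \<and> r = r' \<and> s = s'"
proof
  assume eq: "quadratic_field C D U k l r s = quadratic_field C D U k' l' r' s'"
  \<comment> \<open>The value at the origin does not see r, whose field h d_h - z d_z vanishes
    there; an h-derivative recovers it.\<close>
  have v: "quadratic_field C D U k l r s 0 $ 1 = k" "quadratic_field C D U k l r s 0 $ 2 = l"
    "quadratic_field C D U k l r s 0 $ 3 = s" "pd 2 (\<lambda>p. quadratic_field C D U k l r s p $ 2) 0 = r"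
    for k l r s
    using assms by (simp_all add: quadratic_field_def vec_field_nth pd_simps pd_differentiable
        pd_cong[OF assms(1) vec_field_nth(2) assms(2)])
  show "k = k' \<and> l = l' \<and> r = r' \<and> s = s'"
    using v[of k l r s] v[of k' l' r' s'] eq by metis
qed simp

lemma quadratic_field_0:
  "0 \<in> U \<Longrightarrow> quadratic_field C D U k l r s 0 = 0 \<longleftrightarrow> k = 0 \<and> l = 0 \<and> s = 0"
  by (simp add: quadratic_field_def vec_field_def vec_eq_iff forall_3)

subsection \<open>Killing algebras\<close>

lemma lie_isoI:
  assumes "\<And>x. x \<in> lcarrier L \<Longrightarrow> f x \<in> lcarrier M"
    and "\<And>x y. x \<in> lcarrier L \<Longrightarrow> y \<in> lcarrier L \<Longrightarrow> f (ladd L x y) = ladd M (f x) (f y)"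
    and "\<And>c x. x \<in> lcarrier L \<Longrightarrow> f (lscale L c x) = lscale M c (f x)"
    and "\<And>x y. x \<in> lcarrier L \<Longrightarrow> y \<in> lcarrier L \<Longrightarrow> f (lbracket L x y) = lbracket M (f x) (f y)"
    and "\<And>x y. x \<in> lcarrier L \<Longrightarrow> y \<in> lcarrier L \<Longrightarrow> f x = f y \<Longrightarrow> x = y"
    and "\<And>X. X \<in> lcarrier M \<Longrightarrow> \<exists>x\<in>lcarrier L. X = f x"
  shows "lie_iso f L M"
  unfolding lie_iso_def lie_hom_def bij_betw_def inj_on_def
  using assms by (auto simp: image_iff)

lemma matrix_mult_2: "((A :: real^2^2) ** B) $ i $ j = A$i$1 * B$1$j + A$i$2 * B$2$j"
  by (simp add: matrix_matrix_mult_def sum_2)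

lemma matrix_mult_3: "((A :: real^3^3) ** B) $ i $ j = A$i$1 * B$1$j + A$i$2 * B$2$j + A$i$3 * B$3$j"
  by (simp add: matrix_matrix_mult_def sum_3)

lemma sl2_simps:
  "A \<in> lcarrier sl2 \<longleftrightarrow> A$2$2 = - A$1$1"
  "ladd sl2 = (+)" "lscale sl2 = (*\<^sub>R)" "lbracket sl2 = (\<lambda>X Y. X ** Y - Y ** X)"
  by (auto simp: sl2_def matrix_lie_def trace_def sum_2)

lemma heis_simps:
  "A \<in> lcarrier heis \<longleftrightarrow> A$1$1 = 0 \<and> A$2$1 = 0 \<and> A$2$2 = 0 \<and> A$3$1 = 0 \<and> A$3$2 = 0 \<and> A$3$3 = 0"
  "ladd heis = (+)" "lscale heis = (*\<^sub>R)" "lbracket heis = (\<lambda>X Y. X ** Y - Y ** X)"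
proof -
  have "A = heis_matrix (A$1$2) (A$2$3) (A$1$3)" if "A$1$1 = 0 \<and> A$2$1 = 0 \<and> A$2$2 = 0 \<and> A$3$1 = 0 \<and> A$3$2 = 0 \<and> A$3$3 = 0"
    using that by (simp add: heis_matrix_def vec_eq_iff forall_3)
  then show "A \<in> lcarrier heis \<longleftrightarrow> A$1$1 = 0 \<and> A$2$1 = 0 \<and> A$2$2 = 0 \<and> A$3$1 = 0 \<and> A$3$2 = 0 \<and> A$3$3 = 0"
    by (auto simp: heis_def matrix_lie_def heis_matrix_def)
qed (simp_all add: heis_def matrix_lie_def)

lemma abelian_lie_simps:
  "lcarrier abelian_lie = UNIV" "ladd abelian_lie = (+)" "lscale abelian_lie = (*\<^sub>R)"
  "lbracket abelian_lie = (\<lambda>X Y. 0)"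
  by (simp_all add: abelian_lie_def)

lemma lie_sum_simps:
  "lcarrier (lie_sum L M) = lcarrier L \<times> lcarrier M"
  "ladd (lie_sum L M) p q = (ladd L (fst p) (fst q), ladd M (snd p) (snd q))"
  "lscale (lie_sum L M) c p = (lscale L c (fst p), lscale M c (snd p))"
  "lbracket (lie_sum L M) p q = (lbracket L (fst p) (fst q), lbracket M (snd p) (snd q))"
  by (simp_all add: lie_sum_def)

lemma lie_semidirect_simps:
  "lcarrier (lie_semidirect L M r) = lcarrier L \<times> lcarrier M"
  "ladd (lie_semidirect L M r) p q = (ladd L (fst p) (fst q), ladd M (snd p) (snd q))"
  "lscale (lie_semidirect L M r) c p = (lscale L c (fst p), lscale M c (snd p))"
  "lbracket (lie_semidirect L M r) p q = (lbracket L (fst p) (fst q),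
        ladd M (ladd M (r (fst p) (snd q)) (lscale M (-1) (r (fst q) (snd p))))
               (lbracket M (snd p) (snd q)))"
  by (simp_all add: lie_semidirect_def)

lemma mat2_eq_iff:
  "(A :: real^2^2) = B \<longleftrightarrow> A$1$1 = B$1$1 \<and> A$1$2 = B$1$2 \<and> A$2$1 = B$2$1 \<and> A$2$2 = B$2$2"
  by (auto simp: vec_eq_iff forall_2)

lemma mat3_eq_iff:
  "(A :: real^3^3) = B \<longleftrightarrow> A$1$1 = B$1$1 \<and> A$1$2 = B$1$2 \<and> A$1$3 = B$1$3 \<and>
    A$2$1 = B$2$1 \<and> A$2$2 = B$2$2 \<and> A$2$3 = B$2$3 \<and> A$3$1 = B$3$1 \<and> A$3$2 = B$3$2 \<and> A$3$3 = B$3$3"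
  by (auto simp: vec_eq_iff forall_3)

lemmas mat2_simps = mat2_eq_iff matrix_mult_2
lemmas mat3_simps = mat3_eq_iff matrix_mult_3

text \<open>With R and S the fields belonging to r and s, the standard basis is H = 2 (R - (D/K)
  d_x), E = S, F = -(2/K) d_h; the relation [E, F] = H fixes the coefficient of F. The factor
  \<kappa> rescales the centre and is left free to normalise the isotropy.\<close>

lemma lie_iso_quadratic_sl2:
  assumes U: "open U" "connected U" "0 \<in> U" and C: "C \<noteq> 0" "K \<noteq> 0" and K: "C = K + D\<^sup>2" and "\<kappa> \<noteq> 0"
  shows "lie_iso
    (\<lambda>(t, A). quadratic_field C D U (\<kappa> * t - 2 * A$1$1 * D / K) (- 2 * A$2$1 / K) (2 * A$1$1) (A$1$2))
    (lie_sum (abelian_lie :: real lie_alg) sl2) (killing_algebra (g_CD C D) U)"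
proof (rule lie_isoI, goal_cases)
  case 1
  then show ?case
    by (auto simp: quadratic_field_in_killing_algebra U split: prod.splits)
next
  case (2 x y)
  then show ?case
    by (auto simp: lie_sum_simps sl2_simps abelian_lie_simps ladd_quadratic_field
        quadratic_field_inject[OF U(1,3)] algebra_simps add_divide_distrib diff_divide_distrib split: prod.splits)
next
  case (3 c x)
  then show ?case
    by (auto simp: lie_sum_simps sl2_simps abelian_lie_simps lscale_quadratic_field
        quadratic_field_inject[OF U(1,3)] algebra_simps split: prod.splits)
next
  case (4 x y)
  then show ?case
    using C(2) K by (auto simp: lie_sum_simps sl2_simps abelian_lie_simps lbracket_quadratic_field[OF U(1)]
        quadratic_field_inject[OF U(1,3)] matrix_mult_2 split: prod.splits) (simp_all add: field_simps)
next
  case (5 x y)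
  then show ?case
    using C(2) \<open>\<kappa> \<noteq> 0\<close>
    by (auto simp: lie_sum_simps sl2_simps quadratic_field_inject[OF U(1,3)] mat2_simps)
next
  case (6 X)
  then obtain k l r s where X: "X = quadratic_field C D U k l r s"
    using killing_algebra_quadratic[OF U(1,2) C(1)] by blast
  show ?case
    by (rule bexI[of _ "((k + r * D / K) / \<kappa>, sl2_of_vec (vector [r / 2, s, - K * l / 2]))"])
      (use C(2) \<open>\<kappa> \<noteq> 0\<close> in \<open>auto simp: X sl2_of_vec_def lie_sum_simps sl2_simps abelian_lie_simps
        quadratic_field_inject[OF U(1,3)]\<close>)
qed

text \<open>Describes the isotropy inside the model through the explicit map, so that its inverse
  never has to be computed.\<close>

lemma isotropy_image:
  assumes "lie_iso f L (killing_algebra g U)"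
  shows "inv_into (lcarrier L) f ` isotropy g U = {x \<in> lcarrier L. f x 0 = 0}"
  using assms unfolding isotropy_def lie_iso_def by (intro inv_into_image_Collect) simp

text \<open>The e i are eigenvectors with coordinate functionals c i. The hypothesis
  \<open>proj\<close> says that invariant subspaces contain the eigencomponents of their members; it
  is verified in each use by writing the projections as polynomials in f. An invariant W is then
  spanned by the e i that it contains, and the others span a complement.\<close>

lemma semisimple_on_eigenbasis:
  fixes e :: "'i \<Rightarrow> 'a::real_vector"
  assumes V: "subspace V" and "finite I"
    and c: "\<And>i. i \<in> I \<Longrightarrow> linear (c i)" "\<And>x. x \<in> V \<Longrightarrow> x = (\<Sum>i\<in>I. c i x *\<^sub>R e i)"
      "\<And>i j. i \<in> I \<Longrightarrow> j \<in> I \<Longrightarrow> c i (e j) = (if i = j then 1 else 0)" "\<And>i. i \<in> I \<Longrightarrow> e i \<in> V"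
    and f: "\<And>x. x \<in> V \<Longrightarrow> f x \<in> V" "\<And>x i. x \<in> V \<Longrightarrow> i \<in> I \<Longrightarrow> c i (f x) = l i * c i x"
    and proj: "\<And>W x i. subspace W \<Longrightarrow> W \<subseteq> V \<Longrightarrow> f ` W \<subseteq> W \<Longrightarrow> x \<in> W \<Longrightarrow> i \<in> I \<Longrightarrow> c i x *\<^sub>R e i \<in> W"
  shows "semisimple_on V f"
  unfolding semisimple_on_def
proof (intro allI impI)
  fix W assume W: "subspace W \<and> W \<subseteq> V \<and> f ` W \<subseteq> W"
  \<comment> \<open>The span of the eigenvectors outside W, described by equations so that linearity
    and invariance are immediate.\<close>
  define W' where "W' = {x \<in> V. \<forall>i\<in>I. e i \<in> W \<longrightarrow> c i x = 0}"
  have "subspace W'"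
    using V c(1) unfolding W'_def subspace_def
    by (auto simp: linear_add linear_cmul linear_0)
  moreover have "W' \<subseteq> V"
    by (auto simp: W'_def)
  moreover have "f ` W' \<subseteq> W'"
    using f by (auto simp: W'_def)
  moreover have "W \<inter> W' = {0}"
  proof -
    have "x = 0" if "x \<in> W" "x \<in> W'" for x
    proof -
      have "c i x = 0" if "i \<in> I" for i
      proof (rule ccontr)
        assume "c i x \<noteq> 0"
        moreover have "c i x *\<^sub>R e i \<in> W"
          using W \<open>x \<in> W\<close> \<open>i \<in> I\<close> by (intro proj) auto
        then have "(1 / c i x) *\<^sub>R c i x *\<^sub>R e i \<in> W"
          using W by (blast intro: subspace_scale)
        ultimately have "e i \<in> W"
          by simp
        then show False
          using \<open>x \<in> W'\<close> \<open>i \<in> I\<close> \<open>c i x \<noteq> 0\<close> by (auto simp: W'_def)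
      qed
      moreover have "x \<in> V"
        using that by (simp add: W'_def)
      ultimately show "x = 0"
        by (subst c(2)) auto
    qed
    then show ?thesis
      using W \<open>subspace W'\<close> by (auto simp: subspace_0)
  qed
  moreover have "V = {a + b |a b. a \<in> W \<and> b \<in> W'}"
  proof (intro equalityI subsetI)
    fix x assume x: "x \<in> V"
    define a where "a = (\<Sum>i\<in>{i\<in>I. e i \<in> W}. c i x *\<^sub>R e i)"
    have a: "a \<in> W"
      unfolding a_def using W by (intro subspace_sum) (auto intro: subspace_scale)
    have "c j a = c j x" if "j \<in> I" "e j \<in> W" for j
    proof -
      have "c j a = (\<Sum>i\<in>{i\<in>I. e i \<in> W}. c i x * (if j = i then 1 else 0))"
        unfolding a_def using that
        by (auto simp: linear_sum[OF c(1)] linear_cmul[OF c(1)] c(3) intro!: sum.cong)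
      also have "\<dots> = c j x"
        using that \<open>finite I\<close> by (simp add: if_distrib cong: if_cong)
      finally show ?thesis .
    qed
    then have "x - a \<in> W'"
      using V W a x c(1) by (auto simp: W'_def linear_diff intro: subspace_diff)
    then show "x \<in> {a + b |a b. a \<in> W \<and> b \<in> W'}"
      using a by (intro CollectI exI[of _ a] exI[of _ "x - a"]) simp
  next
    fix x assume "x \<in> {a + b |a b. a \<in> W \<and> b \<in> W'}"
    then show "x \<in> V"
      using W V by (auto simp: W'_def intro: subspace_add)
  qed
  ultimately show "\<exists>W'. subspace W' \<and> W' \<subseteq> V \<and> f ` W' \<subseteq> W' \<and> W \<inter> W' = {0} \<and>
      V = {a + b |a b. a \<in> W \<and> b \<in> W'}"
    by blast
qed

text \<open>Half of the usual H, so that the parameter r = 2 A11 of t times this matrix is t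
  itself.\<close>

definition half_diag :: "real^2^2" where
  "half_diag = vector [vector [1/2, 0], vector [0, -1/2]]"

lemma half_diag_nth:
  "half_diag $ 1 $ 1 = 1/2" "half_diag $ 1 $ 2 = 0" "half_diag $ 2 $ 1 = 0" "half_diag $ 2 $ 2 = -1/2"
  by (simp_all add: half_diag_def)

lemma diagonal_sl2_iff:
  "A$1$2 = 0 \<and> A$2$1 = 0 \<and> A$2$2 = - A$1$1 \<longleftrightarrow> (\<exists>t. A = t *\<^sub>R half_diag)"
  by (auto simp: mat2_eq_iff half_diag_nth intro!: exI[of _ "2 * A$1$1"])

lemma half_diag_nonzero: "half_diag \<noteq> 0"
  by (auto simp: half_diag_nth mat2_simps)

lemma R_semisimple_half_diag: "R_semisimple_sl2 half_diag"
proof -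
  have "matrix_inv (mat 1 :: real^2^2) = mat 1"
    unfolding matrix_inv_def by (rule some_equality) simp_all
  then have "matrix_inv (mat 1 :: real^2^2) ** half_diag ** mat 1 = half_diag"
    by simp
  then have "\<forall>i j. i \<noteq> j \<longrightarrow> (matrix_inv (mat 1) ** half_diag ** mat 1) $ i $ j = 0"
    by (simp add: forall_2 half_diag_nth)
  then show ?thesis
    unfolding R_semisimple_sl2_def
    using half_diag_nonzero by (auto simp: sl2_simps half_diag_nth 
        intro!: exI[of _ "mat 1"] simp: invertible_def)
qed

lemma semisimple_half_diag: "semisimple_sl2 half_diag"
proof -
  have v: "half_diag *v x = vector [x$1 / 2, - x$2 / 2]" for x
    by (simp add: vec_eq_iff forall_2 matrix_vector_mult_def sum_2 half_diag_nth)
  have "semisimple_on UNIV ((*v) half_diag)"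
  proof (rule semisimple_on_eigenbasis[where I = UNIV and e = "\<lambda>i. axis i 1" and c = "\<lambda>i x. x $ i"
        and l = "\<lambda>i. if i = 1 then 1/2 else -1/2"], goal_cases)
    case (4 x)
    then show ?case
      by (simp add: sum_2 vec_eq_iff forall_2 axis_def)
  next
    case (8 x i)
    then show ?case
      using exhaust_2[of i] by (auto simp: v)
  next
    case (9 W x i)
    have s: "half_diag *v x \<in> W"
      using 9 by auto
    \<comment> \<open>For the eigenvalues 1/2 and -1/2 the projections onto the eigenspaces are 1/2
      + s and 1/2 - s, where s is the matrix.\<close>
    have "x $ i *\<^sub>R axis i 1 = (1/2) *\<^sub>R x + half_diag *v x \<or> x $ i *\<^sub>R axis i 1 = (1/2) *\<^sub>R x - half_diag *v x"
      using exhaust_2[of i] by (auto simp: v vec_eq_iff forall_2 axis_def)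
    then show ?case
      using 9(1,4) s by (auto simp: subspace_add subspace_diff subspace_scale)
  qed (auto simp: axis_def bounded_linear.linear bounded_linear_vec_nth)
  then show ?thesis
    by (simp add: semisimple_sl2_def half_diag_nonzero sl2_simps half_diag_nth)
qed

lemma killing_algebra_generic:
  assumes U: "open U" "connected U" "0 \<in> U" and C: "C \<noteq> 0" "C \<noteq> D\<^sup>2" and "D \<noteq> 0"
  shows "\<exists>\<phi> f s. lie_iso \<phi> (killing_algebra (g_CD C D) U) (lie_sum (abelian_lie :: real lie_alg) sl2) \<and>
    R_semisimple_sl2 s \<and> lie_hom f (abelian_lie :: real lie_alg) sl2 \<and> range f \<subseteq> span {s} \<and>
    \<phi> ` isotropy (g_CD C D) U = {(t, f t) |t. True}"
proof -
  define K where "K = C - D\<^sup>2"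
  have K: "K \<noteq> 0" "D / K \<noteq> 0" "C = K + D\<^sup>2"
    using assms by (auto simp: K_def)
  let ?L = "lie_sum (abelian_lie :: real lie_alg) sl2"
  let ?f = "\<lambda>(t, A). quadratic_field C D U (D / K * t - 2 * A$1$1 * D / K) (- 2 * A$2$1 / K) (2 * A$1$1) (A$1$2)"
  \<comment> \<open>Here \<kappa> = D/K. Vanishing at the origin then reads (D/K) (t - 2 A11) = 0
    with A diagonal, that is, A = t times \<open>half_diag\<close>.\<close>
  note iso = lie_iso_quadratic_sl2[OF U C(1) K(1,3,2)]
  have "{x \<in> lcarrier ?L. ?f x 0 = 0} = {(t, t *\<^sub>R half_diag) |t. True}"
    using K \<open>D \<noteq> 0\<close>
    by (auto simp: lie_sum_simps abelian_lie_simps sl2_simps quadratic_field_0[OF U(3)] mat2_simps half_diag_nth)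
  then have "inv_into (lcarrier ?L) ?f ` isotropy (g_CD C D) U = {(t, t *\<^sub>R half_diag) |t. True}"
    by (simp only: isotropy_image[OF iso])
  moreover have "lie_iso (inv_into (lcarrier ?L) ?f) (killing_algebra (g_CD C D) U) ?L"
    by (rule lie_iso_inv_into[OF iso])
      (auto simp: lie_sum_simps abelian_lie_simps sl2_simps matrix_mult_2)
  moreover have "lie_hom (\<lambda>t. t *\<^sub>R half_diag) (abelian_lie :: real lie_alg) sl2"
    by (auto simp: lie_hom_def sl2_simps abelian_lie_simps mat2_simps half_diag_nth scaleR_add_left)
  moreover have "range (\<lambda>t. t *\<^sub>R half_diag) \<subseteq> span {half_diag}"
    by (auto intro: span_scale span_base)
  ultimately show ?thesis
    using R_semisimple_half_diag by blast
qed

text \<open>For D = 0 the correction (D/K) d_x disappears: the field h d_h - z d_z lies in sl(2),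
  and the isotropy has no component in the centre.\<close>

lemma killing_algebra_product:
  assumes U: "open U" "connected U" "0 \<in> U" and C: "C \<noteq> 0"
  shows "\<exists>\<phi> s. lie_iso \<phi> (killing_algebra (g_CD C 0) U) (lie_sum (abelian_lie :: real lie_alg) sl2) \<and>
    semisimple_sl2 s \<and> \<phi> ` isotropy (g_CD C 0) U = {(0, t *\<^sub>R s) |t. True}"
proof -
  let ?L = "lie_sum (abelian_lie :: real lie_alg) sl2"
  let ?f = "\<lambda>(t, A). quadratic_field C 0 U (1 * t - 2 * A$1$1 * 0 / C) (- 2 * A$2$1 / C) (2 * A$1$1) (A$1$2)"
  have iso: "lie_iso ?f ?L (killing_algebra (g_CD C 0) U)"
    using lie_iso_quadratic_sl2[OF U C C, of 0 1] by simp
  have "{x \<in> lcarrier ?L. ?f x 0 = 0} = {(0, t *\<^sub>R half_diag) |t. True}"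
    using C
    by (auto simp: lie_sum_simps abelian_lie_simps sl2_simps quadratic_field_0[OF U(3)] half_diag_nth
        intro: diagonal_sl2_iff[THEN iffD1])
  then have "inv_into (lcarrier ?L) ?f ` isotropy (g_CD C 0) U = {(0, t *\<^sub>R half_diag) |t. True}"
    by (simp only: isotropy_image[OF iso])
  moreover have "lie_iso (inv_into (lcarrier ?L) ?f) (killing_algebra (g_CD C 0) U) ?L"
    by (rule lie_iso_inv_into[OF iso])
      (auto simp: lie_sum_simps abelian_lie_simps sl2_simps matrix_mult_2)
  ultimately show ?thesis
    using semisimple_half_diag by blast
qed

section \<open>The Heisenberg case C = D^2\<close>

definition heis_weight :: "real^3^3 \<Rightarrow> real^3^3" where
  "heis_weight A = heis_matrix (- A$1$2) (A$2$3) 0"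

lemma heis_matrix_nth:
  "heis_matrix a b c $ 1 $ 1 = 0" "heis_matrix a b c $ 1 $ 2 = a" "heis_matrix a b c $ 1 $ 3 = c"
  "heis_matrix a b c $ 2 $ 1 = 0" "heis_matrix a b c $ 2 $ 2 = 0" "heis_matrix a b c $ 2 $ 3 = b"
  "heis_matrix a b c $ 3 $ 1 = 0" "heis_matrix a b c $ 3 $ 2 = 0" "heis_matrix a b c $ 3 $ 3 = 0"
  by (simp_all add: heis_matrix_def)

text \<open>The entries 12, 23, 13 have weights -1, 1, 0. These add up along [E12, E23] = E13, the
  only nonzero bracket of basis vectors up to sign.\<close>

lemma lie_derivation_heis_weight: "lie_derivation heis heis_weight"
  by (auto simp: lie_derivation_def heis_weight_def heis_simps heis_matrix_nth mat3_simps)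

lemma semisimple_heis_weight: "semisimple_on (lcarrier heis) heis_weight"
proof (rule semisimple_on_eigenbasis[where I = UNIV
      and e = "\<lambda>i::3. heis_matrix (if i = 1 then 1 else 0) (if i = 2 then 1 else 0) (if i = 3 then 1 else 0)"
      and c = "\<lambda>i A. if i = 1 then A$1$2 else if i = 2 then A$2$3 else A$1$3"
      and l = "\<lambda>i. if i = 1 then -1 else if i = 2 then 1 else 0"], goal_cases)
  case 1
  then show ?case
    by (auto simp: subspace_def heis_simps)
next
  case (3 i)
  then show ?case
    using exhaust_3[of i] by (auto intro!: linearI)
next
  case (4 x)
  then show ?case
    by (simp add: sum_3 mat3_simps heis_matrix_nth heis_simps)
next
  case (5 i j)
  then show ?case
    using exhaust_3[of i] exhaust_3[of j] by (auto simp: heis_matrix_nth)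
next
  case (8 x i)
  then show ?case
    using exhaust_3[of i] by (auto simp: heis_weight_def heis_matrix_nth)
next
  case (9 W x i)
  have s: "x \<in> W" "heis_weight x \<in> W" "heis_weight (heis_weight x) \<in> W"
    using 9(3,4) by (auto simp: image_subset_iff)
  \<comment> \<open>Lagrange interpolation at the eigenvalues -1, 1, 0: with d the derivation, the
    projections are (d^2 - d)/2, (d^2 + d)/2 and 1 - d^2.\<close>
  have "heis_matrix (x$1$2) 0 0 = (1/2) *\<^sub>R (heis_weight (heis_weight x) - heis_weight x)"
    "heis_matrix 0 (x$2$3) 0 = (1/2) *\<^sub>R (heis_weight (heis_weight x) + heis_weight x)"
    "heis_matrix 0 0 (x$1$3) = x - heis_weight (heis_weight x)"
    using 9(2,4) by (auto simp: heis_weight_def mat3_simps heis_matrix_nth heis_simps dest!: subsetD)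
  then have "heis_matrix (x$1$2) 0 0 \<in> W" "heis_matrix 0 (x$2$3) 0 \<in> W" "heis_matrix 0 0 (x$1$3) \<in> W"
    using s 9(1) by (auto simp: subspace_add subspace_diff subspace_scale)
  moreover have "k *\<^sub>R heis_matrix a b c = heis_matrix (k * a) (k * b) (k * c)" for k a b c
    by (simp add: mat3_simps heis_matrix_nth)
  ultimately show ?case
    using exhaust_3[of i] by auto
qed (auto simp: heis_simps heis_matrix_nth heis_weight_def)

text \<open>E12, E23, E13 go to d_h, S, -D d_x, where S belongs to s; the last coefficient is forced
  by [d_h, S] = -D d_x. The acting parameter t is r, since [R, d_h] = -d_h and [R, S] = S for the
  field R of r.\<close>

lemma lie_iso_quadratic_heis:
  assumes U: "open U" "connected U" "0 \<in> U" and "D \<noteq> 0"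
  shows "lie_iso (\<lambda>(t, A). quadratic_field (D\<^sup>2) D U (- D * A$1$3) (A$1$2) t (A$2$3))
    (lie_semidirect (abelian_lie :: real lie_alg) heis (\<lambda>t X. t *\<^sub>R heis_weight X))
    (killing_algebra (g_CD (D\<^sup>2) D) U)"
proof (rule lie_isoI, goal_cases)
  case 1
  then show ?case
    by (auto simp: quadratic_field_in_killing_algebra U split: prod.splits)
next
  case (2 x y)
  then show ?case
    by (auto simp: lie_semidirect_simps heis_simps abelian_lie_simps ladd_quadratic_field
        quadratic_field_inject[OF U(1,3)] algebra_simps split: prod.splits)
next
  case (3 c x)
  then show ?case
    by (auto simp: lie_semidirect_simps heis_simps abelian_lie_simps lscale_quadratic_field
        quadratic_field_inject[OF U(1,3)] algebra_simps split: prod.splits)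
next
  case (4 x y)
  then show ?case
    by (auto simp: lie_semidirect_simps heis_simps abelian_lie_simps lbracket_quadratic_field[OF U(1)]
        heis_weight_def heis_matrix_nth
        quadratic_field_inject[OF U(1,3)] matrix_mult_3 algebra_simps split: prod.splits)
next
  case (5 x y)
  then show ?case
    using \<open>D \<noteq> 0\<close>
    by (auto simp: lie_semidirect_simps heis_simps quadratic_field_inject[OF U(1,3)] mat3_simps)
next
  case (6 X)
  then obtain k l r s where X: "X = quadratic_field (D\<^sup>2) D U k l r s"
    using killing_algebra_quadratic[OF U(1,2), of "D\<^sup>2" X D thesis] \<open>D \<noteq> 0\<close> by simp
  show ?case
    by (rule bexI[of _ "(r, heis_matrix l s (- k / D))"])
      (use \<open>D \<noteq> 0\<close> in \<open>auto simp: X heis_matrix_nth lie_semidirect_simps heis_simps abelian_lie_simps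
        quadratic_field_inject[OF U(1,3)]\<close>)
qed

lemma killing_algebra_heis:
  assumes U: "open U" "connected U" "0 \<in> U" and "D \<noteq> 0"
  shows "\<exists>\<delta> \<phi>. lie_derivation heis \<delta> \<and> semisimple_on (lcarrier heis) \<delta> \<and>
    lie_iso \<phi> (killing_algebra (g_CD (D\<^sup>2) D) U)
      (lie_semidirect (abelian_lie :: real lie_alg) heis (\<lambda>t X. t *\<^sub>R \<delta> X)) \<and>
    \<phi> ` isotropy (g_CD (D\<^sup>2) D) U = {(t, 0) |t. True}"
proof -
  let ?L = "lie_semidirect (abelian_lie :: real lie_alg) heis (\<lambda>t X. t *\<^sub>R heis_weight X)"
  let ?f = "\<lambda>(t, A). quadratic_field (D\<^sup>2) D U (- D * A$1$3) (A$1$2) t (A$2$3)"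
  note iso = lie_iso_quadratic_heis[OF assms]
  have "{x \<in> lcarrier ?L. ?f x 0 = 0} = {(t, 0) |t. True}"
    using \<open>D \<noteq> 0\<close>
    by (auto simp: lie_semidirect_simps abelian_lie_simps heis_simps quadratic_field_0[OF U(3)] mat3_simps)
  then have "inv_into (lcarrier ?L) ?f ` isotropy (g_CD (D\<^sup>2) D) U = {(t, 0) |t. True}"
    by (simp only: isotropy_image[OF iso])
  moreover have "lie_iso (inv_into (lcarrier ?L) ?f) (killing_algebra (g_CD (D\<^sup>2) D) U) ?L"
    by (rule lie_iso_inv_into[OF iso])
      (auto simp: lie_semidirect_simps abelian_lie_simps heis_simps matrix_mult_3 heis_weight_def heis_matrix_nth)
  ultimately show ?thesis
    using lie_derivation_heis_weight semisimple_heis_weight by blast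
qed

section \<open>The exponential family, all Killing fields for C = 0 and nonzero D\<close>

definition exp_field :: "real \<Rightarrow> (real^3) set \<Rightarrow> real \<Rightarrow> real \<Rightarrow> real \<Rightarrow> real \<Rightarrow> real \<Rightarrow> real \<Rightarrow> real^3 \<Rightarrow> real^3" where
  "exp_field D U k l r s u v = vec_field U
    (\<lambda>p. k - D * s * p$2 - D * u * p$3 * exp (D * p$1))
    (\<lambda>p. l + r * p$2 - D\<^sup>2 / 2 * s * (p$2)\<^sup>2 + u * exp (D * p$1))
    (\<lambda>p. s - p$3 * (r - D\<^sup>2 * s * p$2) + D\<^sup>2 / 2 * u * (p$3)\<^sup>2 * exp (D * p$1) + v * exp (- (D * p$1)))"

lemma killing_system_exp:
  assumes "open U" and "connected U"
  shows "killing_system U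
    (\<lambda>p. k - D * s * p$2 - D * u * p$3 * exp (D * p$1))
    (\<lambda>p. l + r * p$2 - D\<^sup>2 / 2 * s * (p$2)\<^sup>2 + u * exp (D * p$1))
    (\<lambda>p. s - p$3 * (r - D\<^sup>2 * s * p$2) + D\<^sup>2 / 2 * u * (p$3)\<^sup>2 * exp (D * p$1) + v * exp (- (D * p$1))) 0 D"
  by unfold_locales
    (intro smooth_on_intros assms | simp add: assms pd_simps pd_differentiable power2_eq_square field_simps)+

lemma exp_field_in_killing_algebra:
  "open U \<Longrightarrow> connected U \<Longrightarrow> exp_field D U k l r s u v \<in> lcarrier (killing_algebra (g_CD 0 D) U)"
  unfolding exp_field_def by (intro vec_field_in_killing_algebra killing_system_exp)

lemma killing_algebra_exp:
  assumes "open U" and "connected U" and "D \<noteq> 0" and "X \<in> lcarrier (killing_algebra (g_CD 0 D) U)"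
  obtains k l r s u v where "X = exp_field D U k l r s u v"
proof -
  interpret killing_system U "\<lambda>p. X p $ 1" "\<lambda>p. X p $ 2" "\<lambda>p. X p $ 3" 0 D
    using assms by (simp add: killing_algebra_g_CD_iff)
  have z: "p \<notin> U \<Longrightarrow> X p = 0" for p
    using assms by (simp add: killing_algebra_g_CD_iff)
  show thesis
  proof (rule solution_C_zero[OF refl assms(3)])
    fix k l r s u v
    assume sol: "\<And>p. p \<in> U \<Longrightarrow> X p $ 1 = k + s * p $ 2 - D * u * p $ 3 * exp (D * p $ 1)"
      "\<And>p. p \<in> U \<Longrightarrow> X p $ 2 = l + r * p $ 2 + D * s / 2 * (p $ 2)\<^sup>2 + u * exp (D * p $ 1)"
      "\<And>p. p \<in> U \<Longrightarrow> X p $ 3 = - s / D - p $ 3 * (r + D * s * p $ 2) +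
          D\<^sup>2 * u / 2 * (p $ 3)\<^sup>2 * exp (D * p $ 1) + v * exp (- (D * p $ 1))"
    \<comment> \<open>The parameter s is changed to the constant term of the z-component, as in the
      quadratic family.\<close>
    have "X = exp_field D U k l r (- s / D) u v"
      unfolding exp_field_def using assms(3)
      by (intro vec_field_eqI z) (simp_all add: sol power2_eq_square)
    then show thesis
      by (rule that)
  qed
qed

lemma ladd_exp_field:
  "ladd (killing_algebra g U) (exp_field D U k l r s u v) (exp_field D U k' l' r' s' u' v') =
    exp_field D U (k + k') (l + l') (r + r') (s + s') (u + u') (v + v')"
  by (simp add: exp_field_def ladd_vec_field algebra_simps add_divide_distrib diff_divide_distrib)

lemma lscale_exp_field:
  "lscale (killing_algebra g U) c (exp_field D U k l r s u v) =
    exp_field D U (c * k) (c * l) (c * r) (c * s) (c * u) (c * v)"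
  by (simp add: exp_field_def lscale_vec_field algebra_simps)

lemma lbracket_exp_field:
  assumes "open U"
  shows "lbracket (killing_algebra g U) (exp_field D U k l r s u v) (exp_field D U k' l' r' s' u' v') =
    exp_field D U (- D * (l * s' - s * l') + D * (u * v' - v * u')) (l * r' - r * l')
      (- D\<^sup>2 * (l * s' - s * l')) (r * s' - s * r')
      (D * (k * u' - u * k') - (r * u' - u * r')) (- D * (k * v' - v * k') + (r * v' - v * r'))"
proof -
  \<comment> \<open>The only relation needed between the exponentials. With it, and with J in place
    of D^2/2 to avoid fractions, the identities become polynomial ones for
    \<open>algebra\<close>.\<close>
  have e: "exp (D * p$1) * exp (- (D * p$1)) = 1" for p :: "real^3"
    by (simp flip: exp_add)
  define J where "J = D\<^sup>2 / 2"
  have J: "D\<^sup>2 = 2 * J"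
    by (simp add: J_def)
  show ?thesis
    unfolding exp_field_def J_def[symmetric]
    apply (subst lbracket_vec_field[OF assms]; (intro smooth_on_intros assms)?)
    apply (rule vec_field_eqI)
    apply (simp add: vec_field_def)
    apply (simp_all add: vec_field_nth pd_simps pd_differentiable del: distrib_left_numeral distrib_right_numeral)
    subgoal for p using e[of p] J by algebra
    subgoal for p using e[of p] J by algebra
    subgoal for p using e[of p] J by algebra
    done
qed

lemma exp_field_inject:
  assumes "open U" and "0 \<in> U" and "D \<noteq> 0"
  shows "exp_field D U k l r s u v = exp_field D U k' l' r' s' u' v' \<longleftrightarrow>
    k = k' \<and> l = l' \<and> r = r' \<and> s = s' \<and> u = u' \<and> v = v'"
proof
  assume eq: "exp_field D U k l r s u v = exp_field D U k' l' r' s' u' v'"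
  let ?X = "\<lambda>k l r s u v. exp_field D U k l r s u v"
  \<comment> \<open>Values at the origin give only l + u and s + v; the x-derivatives D u and -D v
    separate the summands because D is nonzero.\<close>
  have w: "?X k l r s u v 0 $ 1 = k" "?X k l r s u v 0 $ 2 = l + u" "?X k l r s u v 0 $ 3 = s + v"
    "pd 2 (\<lambda>p. ?X k l r s u v p $ 2) 0 = r" "pd 1 (\<lambda>p. ?X k l r s u v p $ 2) 0 = D * u"
    "pd 1 (\<lambda>p. ?X k l r s u v p $ 3) 0 = - D * v"
    for k l r s u v
    using assms by (simp_all add: exp_field_def vec_field_nth pd_simps pd_differentiable
        pd_cong[OF assms(1) vec_field_nth(2) assms(2)] pd_cong[OF assms(1) vec_field_nth(3) assms(2)])
  have "k = k'" "l + u = l' + u'" "s + v = s' + v'" "r = r'" "D * u = D * u'" "- D * v = - D * v'"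
    using w[of k l r s u v] w[of k' l' r' s' u' v'] eq by metis+
  then show "k = k' \<and> l = l' \<and> r = r' \<and> s = s' \<and> u = u' \<and> v = v'"
    using assms(3) by auto
qed simp

text \<open>The fields with u = v = 0 are the quadratic ones for C = 0, and the factor A is their
  copy of sl(2) with K = -D^2. The factor B has H = (2/D) d_x with the fields of u and v as E and,
  up to scale, F. The summand (2/D) d_x in the H of A makes it commute with those two.\<close>

lemma lie_iso_exp_sl2_sl2:
  assumes U: "open U" "connected U" "0 \<in> U" and "D \<noteq> 0"
  shows "lie_iso
    (\<lambda>(A, B). exp_field D U (2 * (A$1$1 + B$1$1) / D) (2 * A$2$1 / D\<^sup>2) (2 * A$1$1) (A$1$2)
      (B$1$2) (2 * B$2$1 / D\<^sup>2))
    (lie_sum sl2 sl2) (killing_algebra (g_CD 0 D) U)"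
proof (rule lie_isoI, goal_cases)
  case 1
  then show ?case
    by (auto simp: exp_field_in_killing_algebra U split: prod.splits)
next
  case (2 x y)
  then show ?case
    by (auto simp: lie_sum_simps sl2_simps ladd_exp_field
        exp_field_inject[OF U(1,3) \<open>D \<noteq> 0\<close>] algebra_simps add_divide_distrib diff_divide_distrib split: prod.splits)
next
  case (3 c x)
  then show ?case
    by (auto simp: lie_sum_simps sl2_simps lscale_exp_field
        exp_field_inject[OF U(1,3) \<open>D \<noteq> 0\<close>] algebra_simps add_divide_distrib split: prod.splits)
next
  case (4 x y)
  then show ?case
    using \<open>D \<noteq> 0\<close> by (auto simp: lie_sum_simps sl2_simps lbracket_exp_field[OF U(1)]
        exp_field_inject[OF U(1,3) \<open>D \<noteq> 0\<close>] matrix_mult_2 split: prod.splits)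
      (simp_all add: field_simps power2_eq_square)
next
  case (5 x y)
  then show ?case
    using \<open>D \<noteq> 0\<close>
    by (auto simp: lie_sum_simps sl2_simps exp_field_inject[OF U(1,3) \<open>D \<noteq> 0\<close>] mat2_simps)
next
  case (6 X)
  then obtain k l r s u v where X: "X = exp_field D U k l r s u v"
    using killing_algebra_exp[OF U(1,2) \<open>D \<noteq> 0\<close>] by blast
  show ?case
    by (rule bexI[of _ "(sl2_of_vec (vector [r / 2, s, D\<^sup>2 * l / 2]),
          sl2_of_vec (vector [(k * D - r) / 2, u, D\<^sup>2 * v / 2]))"])
      (use \<open>D \<noteq> 0\<close> in \<open>auto simp: X sl2_of_vec_def lie_sum_simps sl2_simps
        exp_field_inject[OF U(1,3) \<open>D \<noteq> 0\<close>] field_simps\<close>)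
qed

lemma killing_algebra_AdS:
  assumes "open U" "connected U" "0 \<in> U" and "D \<noteq> 0"
  shows "lie_isomorphic (killing_algebra (g_CD 0 D) U) (lie_sum sl2 sl2)"
  unfolding lie_isomorphic_def
  by (rule exI, rule lie_iso_inv_into[OF lie_iso_exp_sl2_sl2[OF assms]])
    (auto simp: lie_sum_simps sl2_simps matrix_mult_2)

section \<open>The affine family, all Killing fields for C = D = 0\<close>

definition affine_field :: "(real^3) set \<Rightarrow> real \<Rightarrow> real \<Rightarrow> real \<Rightarrow> real \<Rightarrow> real \<Rightarrow> real \<Rightarrow> real^3 \<Rightarrow> real^3" where
  "affine_field U k l m r s u = vec_field U
    (\<lambda>p. k + s * p$2 - u * p$3) (\<lambda>p. l + r * p$2 + u * p$1) (\<lambda>p. m - r * p$3 - s * p$1)"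

lemma affine_field_in_killing_algebra:
  assumes "open U" "connected U"
  shows "affine_field U k l m r s u \<in> lcarrier (killing_algebra (g_CD 0 0) U)"
  unfolding affine_field_def
  by (intro vec_field_in_killing_algebra, unfold_locales)
    (intro smooth_on_intros assms | simp add: assms pd_simps pd_differentiable)+

lemma killing_algebra_affine:
  assumes "open U" and "connected U" and "X \<in> lcarrier (killing_algebra (g_CD 0 0) U)"
  obtains k l m r s u where "X = affine_field U k l m r s u"
proof -
  interpret killing_system U "\<lambda>p. X p $ 1" "\<lambda>p. X p $ 2" "\<lambda>p. X p $ 3" 0 0
    using assms by (simp add: killing_algebra_g_CD_iff)
  have z: "p \<notin> U \<Longrightarrow> X p = 0" for p
    using assms by (simp add: killing_algebra_g_CD_iff)
  show thesis
  proof (rule solution_flat[OF refl refl])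
    fix k l m s u r
    assume "\<And>p. p \<in> U \<Longrightarrow> X p $ 1 = k + s * p $ 2 - u * p $ 3"
      "\<And>p. p \<in> U \<Longrightarrow> X p $ 2 = l + r * p $ 2 + u * p $ 1"
      "\<And>p. p \<in> U \<Longrightarrow> X p $ 3 = m - r * p $ 3 - s * p $ 1"
    from vec_field_eqI[OF z this] show thesis
      by (intro that) (simp add: affine_field_def)
  qed
qed

lemma ladd_affine_field:
  "ladd (killing_algebra g U) (affine_field U k l m r s u) (affine_field U k' l' m' r' s' u') =
    affine_field U (k + k') (l + l') (m + m') (r + r') (s + s') (u + u')"
  by (simp add: affine_field_def ladd_vec_field algebra_simps)

lemma lscale_affine_field:
  "lscale (killing_algebra g U) c (affine_field U k l m r s u) =
    affine_field U (c * k) (c * l) (c * m) (c * r) (c * s) (c * u)"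
  by (simp add: affine_field_def lscale_vec_field algebra_simps)

lemma lbracket_affine_field:
  assumes "open U"
  shows "lbracket (killing_algebra g U) (affine_field U k l m r s u) (affine_field U k' l' m' r' s' u') =
    affine_field U (l * s' - m * u' - l' * s + m' * u) (l * r' + k * u' - l' * r - k' * u)
      (- m * r' - k * s' + m' * r + k' * s) (s * u' - u * s') (r * s' - s * r') (u * r' - r * u')"
  unfolding affine_field_def
  by (subst lbracket_vec_field[OF assms]; (intro smooth_on_intros assms)?)
    (auto simp: vec_field_def fun_eq_iff vec_eq_iff forall_3 pd_simps pd_differentiable algebra_simps)

lemma affine_field_inject:
  assumes "open U" and "0 \<in> U"
  shows "affine_field U k l m r s u = affine_field U k' l' m' r' s' u' \<longleftrightarrow>
    k = k' \<and> l = l' \<and> m = m' \<and> r = r' \<and> s = s' \<and> u = u'"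
proof
  assume eq: "affine_field U k l m r s u = affine_field U k' l' m' r' s' u'"
  let ?X = "\<lambda>k l m r s u. affine_field U k l m r s u"
  have w: "?X k l m r s u 0 $ 1 = k" "?X k l m r s u 0 $ 2 = l" "?X k l m r s u 0 $ 3 = m"
    "pd 2 (\<lambda>p. ?X k l m r s u p $ 2) 0 = r" "pd 2 (\<lambda>p. ?X k l m r s u p $ 1) 0 = s"
    "pd 1 (\<lambda>p. ?X k l m r s u p $ 2) 0 = u"
    for k l m r s u
    using assms by (simp_all add: affine_field_def vec_field_nth pd_simps pd_differentiable
        pd_cong[OF assms(1) vec_field_nth(1) assms(2)] pd_cong[OF assms(1) vec_field_nth(2) assms(2)])
  show "k = k' \<and> l = l' \<and> m = m' \<and> r = r' \<and> s = s' \<and> u = u'"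
    using w[of k l m r s u] w[of k' l' m' r' s' u'] eq by metis
qed simp

lemma sl2_act_nth:
  "sl2_act A v $ 1 = A$1$2 * v$3 - v$2 * A$2$1"
  "sl2_act A v $ 2 = A$1$1 * v$2 - A$1$2 * v$1 - (v$1 * A$1$2 + v$2 * A$2$2)"
  "sl2_act A v $ 3 = A$2$1 * v$1 + A$2$2 * v$3 - (v$3 * A$1$1 - v$1 * A$2$1)"
  by (simp_all add: sl2_act_def vec_of_sl2_def sl2_of_vec_def matrix_mult_2)

text \<open>Halving v2 turns v1^2 + v2 v3, which \<open>sl2_act\<close> preserves, into dx^2 + 2 dh
  dz. The linear part of the field is minus the action of A, because the bracket of linear fields is
  minus the commutator of their matrices.\<close>

lemma lie_iso_affine:
  assumes U: "open U" "connected U" "0 \<in> U"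
  shows "lie_iso
    (\<lambda>(A, v). affine_field U (v$1) (v$2 / 2) (v$3) (- 2 * A$1$1) (2 * A$2$1) (A$1$2))
    (lie_semidirect sl2 (abelian_lie :: (real^3) lie_alg) sl2_act) (killing_algebra (g_CD 0 0) U)"
proof (rule lie_isoI, goal_cases)
  case 1
  then show ?case
    by (auto simp: affine_field_in_killing_algebra U split: prod.splits)
next
  case (2 x y)
  then show ?case
    by (auto simp: lie_semidirect_simps sl2_simps abelian_lie_simps ladd_affine_field
        affine_field_inject[OF U(1,3)] algebra_simps add_divide_distrib split: prod.splits)
next
  case (3 c x)
  then show ?case
    by (auto simp: lie_semidirect_simps sl2_simps abelian_lie_simps lscale_affine_field
        affine_field_inject[OF U(1,3)] algebra_simps split: prod.splits)
next
  case (4 x y)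
  then show ?case
    by (auto simp: lie_semidirect_simps sl2_simps abelian_lie_simps lbracket_affine_field[OF U(1)]
        affine_field_inject[OF U(1,3)] matrix_mult_2 sl2_act_nth split: prod.splits)
next
  case (5 x y)
  then show ?case
    by (auto simp: lie_semidirect_simps sl2_simps affine_field_inject[OF U(1,3)] mat2_simps vec_eq_iff forall_3)
next
  case (6 X)
  then obtain k l m r s u where X: "X = affine_field U k l m r s u"
    using killing_algebra_affine[OF U(1,2)] by blast
  show ?case
    by (rule bexI[of _ "(sl2_of_vec (vector [- r / 2, u, s / 2]), vector [k, 2 * l, m])"])
      (auto simp: X sl2_of_vec_def lie_semidirect_simps sl2_simps abelian_lie_simps
        affine_field_inject[OF U(1,3)])
qed

lemma killing_algebra_Min:
  assumes "open U" "connected U" "0 \<in> U"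
  shows "lie_isomorphic (killing_algebra (g_CD 0 0) U)
    (lie_semidirect sl2 (abelian_lie :: (real^3) lie_alg) sl2_act)"
  unfolding lie_isomorphic_def
  by (rule exI, rule lie_iso_inv_into[OF lie_iso_affine[OF assms]])
    (auto simp: lie_semidirect_simps abelian_lie_simps sl2_simps matrix_mult_2)

subsection \<open>Local isometries\<close>

text \<open>Testing against d_z, d_x, d_h in this order gives a triangular system.\<close>

lemma g_CD_nondegenerate:
  assumes "\<And>w. g_CD C D p v w = 0"
  shows "v = 0"
proof -
  have "v$2 = 0" "v$1 + D * p$3 * v$2 = 0" "v$3 + C * (p$3)\<^sup>2 * v$2 + D * p$3 * v$1 = 0"
    using assms[of "axis 3 1"] assms[of "axis 1 1"] assms[of "axis 2 1"]
    by (simp_all add: g_CD_def axis_def)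
  then show ?thesis
    by (simp add: vec_eq_iff forall_3)
qed

text \<open>Reduces a local isometry to formulas. Injectivity of the derivative comes for free: a
  vector in its kernel would be orthogonal to everything, against nondegeneracy. The inverse need
  only be continuous on an open subset of the ambient space.\<close>

lemma locally_isometric_g_CDI:
  fixes M :: "'b::euclidean_space set" and \<phi> :: "real^3 \<Rightarrow> real^3 \<Rightarrow> 'b"
  assumes "open U"
    and V: "\<And>p. open (V p)" "\<And>p. p \<in> V p"
    and smooth: "\<And>p. smooth_on UNIV (\<phi> p)"
    and deriv: "\<And>p q. (\<phi> p has_derivative \<phi>' p q) (at q)"
    and W: "open W" "\<And>p. continuous_on W (\<psi> p)" "\<And>p q. q \<in> V p \<Longrightarrow> \<phi> p q \<in> M \<inter> W"
    and inv: "\<And>p q. q \<in> V p \<Longrightarrow> \<psi> p (\<phi> p q) = q" "\<And>p y. y \<in> M \<inter> W \<Longrightarrow> \<phi> p (\<psi> p y) = y"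
    and h: "\<And>p w. h p 0 w = 0"
    and isom: "\<And>p q v w. g_CD C D q v w = h (\<phi> p q) (\<phi>' p q v) (\<phi>' p q w)"
  shows "locally_isometric U (g_CD C D) M h"
  unfolding locally_isometric_def
proof
  fix p assume p: "p \<in> U"
  define N where "N = U \<inter> V p"
  have N: "open N" "p \<in> N" "N \<subseteq> U" "N \<subseteq> V p"
    using assms(1) V p by (auto simp: N_def)
  have fd: "frechet_derivative (\<phi> p) (at q) = \<phi>' p q" for q
    using frechet_derivative_at[OF deriv] by simp
  \<comment> \<open>The image is cut out of M by an ambient open condition, hence relatively
    open.\<close>
  have image: "\<phi> p ` N = M \<inter> (\<psi> p -` N \<inter> W)"
  proof (intro equalityI subsetI)
    fix y assume "y \<in> \<phi> p ` N"
    then obtain q where q: "q \<in> N" "y = \<phi> p q"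
      by auto
    then have "q \<in> V p"
      using N by auto
    then show "y \<in> M \<inter> (\<psi> p -` N \<inter> W)"
      using q W(3)[of q p] inv(1)[of q p] by simp
  next
    fix y assume "y \<in> M \<inter> (\<psi> p -` N \<inter> W)"
    then show "y \<in> \<phi> p ` N"
      using inv(2)[of y p] by (intro image_eqI[of _ _ "\<psi> p y"]) auto
  qed
  have "open (\<psi> p -` N \<inter> W)"
    using W(1,2) N(1) by (simp add: continuous_on_open_vimage)
  then have "openin (top_of_set M) (\<phi> p ` N)"
    unfolding image by (auto simp: openin_open)
  moreover have "homeomorphism N (\<phi> p ` N) (\<phi> p) (\<psi> p)"
  proof (rule homeomorphismI)
    show "continuous_on N (\<phi> p)"
      using smooth_on_imp_continuous_on[OF smooth] by (rule continuous_on_subset) simp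
    show "continuous_on (\<phi> p ` N) (\<psi> p)"
      using W(2) by (rule continuous_on_subset) (auto simp: image)
  qed (use inv(1) N(4) in auto)
  moreover have "inj (\<phi>' p q)" for q
  proof (rule injI)
    fix v v' assume "\<phi>' p q v = \<phi>' p q v'"
    then have "\<phi>' p q (v - v') = 0"
      using has_derivative_linear[OF deriv] by (simp add: linear_diff)
    then have "g_CD C D q (v - v') w = 0" for w
      using isom[of q "v - v'" w p] h by simp
    then show "v = v'"
      using g_CD_nondegenerate[of C D q "v - v'"] by simp
  qed
  moreover have "smooth_on N (\<phi> p)"
    using smooth by (rule smooth_on_subset) simp
  ultimately show "\<exists>V \<phi> \<psi>. open V \<and> p \<in> V \<and> V \<subseteq> U \<and> smooth_on V \<phi> \<and>
      openin (top_of_set M) (\<phi> ` V) \<and> homeomorphism V (\<phi> ` V) \<phi> \<psi> \<and>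
      (\<forall>q\<in>V. inj (frechet_derivative \<phi> (at q)) \<and>
        (\<forall>v w. g_CD C D q v w = h (\<phi> q) (frechet_derivative \<phi> (at q) v) (frechet_derivative \<phi> (at q) w)))"
    using N isom by (intro exI[of _ N] exI[of _ "\<phi> p"] exI[of _ "\<psi> p"]) (auto simp: fd)
qed

lemma has_derivative_vecI:
  fixes f :: "'a::real_normed_vector \<Rightarrow> 'b::euclidean_space^'n"
  assumes "\<And>i. ((\<lambda>x. f x $ i) has_derivative (\<lambda>v. f' v $ i)) (at p)"
  shows "(f has_derivative f') (at p)"
  unfolding has_derivative_componentwise_within[of f f' p UNIV]
  using has_derivative_inner_left[OF assms] by (auto simp: Basis_vec_def inner_axis)

lemma vector_4 [simp]:
  "(vector [a, b, c, d] :: ('a::zero)^4) $ 1 = a" "(vector [a, b, c, d] :: ('a::zero)^4) $ 2 = b"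
  "(vector [a, b, c, d] :: ('a::zero)^4) $ 3 = c" "(vector [a, b, c, d] :: ('a::zero)^4) $ 4 = d"
  unfolding vector_def by auto

lemma continuous_on_vecI:
  fixes f :: "'a::topological_space \<Rightarrow> 'b::topological_space^'n"
  assumes "\<And>i. continuous_on S (\<lambda>x. f x $ i)"
  shows "continuous_on S f"
  using continuous_on_vec_lambda[of S "\<lambda>i x. f x $ i"] assms by simp

lemma smooth_on_vector_3:
  fixes a b c :: "'a::euclidean_space \<Rightarrow> 'b::euclidean_space"
  assumes "open S" "smooth_on S a" "smooth_on S b" "smooth_on S c"
  shows "smooth_on S (\<lambda>x. vector [a x, b x, c x] :: 'b^3)"
proof (rule smooth_on_vecI[OF assms(1)])
  fix i :: 3
  show "smooth_on S (\<lambda>x. (vector [a x, b x, c x] :: 'b^3) $ i)"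
    using exhaust_3[of i] assms by auto
qed

lemma smooth_on_vector_2:
  fixes a b :: "'a::euclidean_space \<Rightarrow> 'b::euclidean_space"
  assumes "open S" "smooth_on S a" "smooth_on S b"
  shows "smooth_on S (\<lambda>x. vector [a x, b x] :: 'b^2)"
proof (rule smooth_on_vecI[OF assms(1)])
  fix i :: 2
  show "smooth_on S (\<lambda>x. (vector [a x, b x] :: 'b^2) $ i)"
    using exhaust_2[of i] assms by auto
qed

lemma has_derivative_vector_3:
  fixes a b c :: "'a::real_normed_vector \<Rightarrow> 'b::euclidean_space"
  assumes "(a has_derivative a') (at p)" "(b has_derivative b') (at p)" "(c has_derivative c') (at p)"
  shows "((\<lambda>x. vector [a x, b x, c x] :: 'b^3) has_derivative (\<lambda>v. vector [a' v, b' v, c' v])) (at p)"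
proof (rule has_derivative_vecI)
  fix i :: 3
  show "((\<lambda>x. (vector [a x, b x, c x] :: 'b^3) $ i) has_derivative (\<lambda>v. (vector [a' v, b' v, c' v] :: 'b^3) $ i)) (at p)"
    using exhaust_3[of i] assms by auto
qed

lemma has_derivative_vector_2:
  fixes a b :: "'a::real_normed_vector \<Rightarrow> 'b::euclidean_space"
  assumes "(a has_derivative a') (at p)" "(b has_derivative b') (at p)"
  shows "((\<lambda>x. vector [a x, b x] :: 'b^2) has_derivative (\<lambda>v. vector [a' v, b' v])) (at p)"
proof (rule has_derivative_vecI)
  fix i :: 2
  show "((\<lambda>x. (vector [a x, b x] :: 'b^2) $ i) has_derivative (\<lambda>v. (vector [a' v, b' v] :: 'b^2) $ i)) (at p)"
    using exhaust_2[of i] assms by auto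
qed

lemma continuous_on_vector_3:
  fixes a b c :: "'a::topological_space \<Rightarrow> real"
  assumes "continuous_on S a" "continuous_on S b" "continuous_on S c"
  shows "continuous_on S (\<lambda>x. vector [a x, b x, c x] :: real^3)"
proof (rule continuous_on_vecI)
  fix i :: 3
  show "continuous_on S (\<lambda>x. (vector [a x, b x, c x] :: real^3) $ i)"
    using exhaust_3[of i] assms by auto
qed

lemmas smooth_vector_intros = smooth_on_vector_3 smooth_on_vector_2 smooth_on_Pair smooth_on_intros open_UNIV

lemmas nth_derivative_intros = derivative_eq_intros
  bounded_linear_imp_has_derivative[OF bounded_linear_vec_nth]

lemma vec3_eq_iff: "(v :: 'a^3) = w \<longleftrightarrow> v$1 = w$1 \<and> v$2 = w$2 \<and> v$3 = w$3"
  by (simp add: vec_eq_iff forall_3)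

section \<open>Charts for the flat and the product case\<close>

lemma locally_isometric_Min3: "open U \<Longrightarrow> locally_isometric U (g_CD 0 0) Min3 Min3_metric"
\<comment> \<open>With y2 - y1 = 2 h and y1 + y2 = z, the form -dy1^2 + dy2^2 factors as 2 dh
  dz.\<close>
proof (rule locally_isometric_g_CDI[where V = "\<lambda>_. UNIV" and W = UNIV
      and \<phi> = "\<lambda>_ q. vector [q$3 / 2 - q$2, q$3 / 2 + q$2, q$1]"
      and \<phi>' = "\<lambda>_ q v. vector [v$3 / 2 - v$2, v$3 / 2 + v$2, v$1]"
      and \<psi> = "\<lambda>_ y. vector [y$3, (y$2 - y$1) / 2, y$1 + y$2]"], goal_cases)
  case (4 p)
  show ?case
    by (intro smooth_vector_intros)
next
  case (5 p q)
  show ?case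
    by (rule has_derivative_vector_3) (auto intro!: nth_derivative_intros)
next
  case (7 p)
  show ?case
    by (intro continuous_on_vector_3 continuous_intros) auto
qed (auto simp: Min3_def Min3_metric_def form12_def g_CD_def vec3_eq_iff field_simps)

text \<open>A negative C gives a negative scale; the dS2 metric with reversed sign is still
  Lorentzian, as the dimension is two.\<close>

lemma locally_isometric_R_dS2:
  assumes "open U" and C: "C \<noteq> 0"
  shows "locally_isometric U (g_CD C 0) (UNIV \<times> dS2)
    (product_metric line_metric (scale_metric (1 / C) dS2_metric))"
  using assms(1)
\<comment> \<open>Null coordinates on the quadric: Y2 - Y1 = h (2 - C h z), Y1 + Y2 = C z, Y3 = 1 -
  C h z. As the metric does not depend on h, h is measured from the base point, which is thus sent
  to Y3 = 1. The excluded set is Y3 = -1, where h = (Y2 - Y1)/(1 + Y3) breaks down.\<close>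
proof (rule locally_isometric_g_CDI[where V = "\<lambda>p. {q. C * (q$2 - p$2) * q$3 \<noteq> 2}"
      and W = "{y. snd y $ 3 \<noteq> -1}"
      and \<phi> = "\<lambda>p q. let h = q$2 - p$2; a = h * (2 - C * h * q$3); b = C * q$3 in
        (q$1, vector [(b - a) / 2, (a + b) / 2, 1 - C * h * q$3])"
      and \<phi>' = "\<lambda>p q v. let h = q$2 - p$2;
          a = 2 * v$2 - C * (2 * h * v$2 * q$3 + h\<^sup>2 * v$3); b = C * v$3 in
        (v$1, vector [(b - a) / 2, (a + b) / 2, - C * (v$2 * q$3 + h * v$3)])"
      and \<psi> = "\<lambda>p y. vector [fst y, p$2 + (snd y$2 - snd y$1) / (1 + snd y$3), (snd y$1 + snd y$2) / C]"], goal_cases)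
  case (1 p)
  show ?case
    by (intro open_Collect_neq continuous_intros)
next
  case (3 p)
  show ?case
    unfolding Let_def by (intro smooth_vector_intros)
next
  case (4 p q)
  show ?case
    unfolding Let_def
    by (intro has_derivative_Pair has_derivative_vector_3)
      (auto intro!: nth_derivative_intros simp: fun_eq_iff power2_eq_square field_simps)
next
  case 5
  show ?case
    by (intro open_Collect_neq continuous_intros)
next
  case (6 p)
  show ?case
    by (intro continuous_on_vector_3 continuous_intros) (use C in \<open>auto simp: add_eq_0_iff\<close>)
next
  case (7 p q)
  then show ?case
    by (auto simp: Let_def dS2_def form12_def power2_eq_square field_simps)
next
  case (8 p q)
  then show ?case
    using C by (auto simp: Let_def vec3_eq_iff field_simps)
next
  case (9 p y)
  \<comment> \<open>The equation of the quadric factored in null coordinates; dividing by 1 + Y3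
    recovers Y3.\<close>
  then have y: "(snd y$2 - snd y$1) * (snd y$1 + snd y$2) = (1 - snd y$3) * (1 + snd y$3)"
    and y3: "1 + snd y$3 \<noteq> 0"
    by (auto simp: dS2_def form12_def algebra_simps add_eq_0_iff)
  have "C * ((snd y$2 - snd y$1) / (1 + snd y$3)) * ((snd y$1 + snd y$2) / C) =
      ((snd y$2 - snd y$1) * (snd y$1 + snd y$2)) / (1 + snd y$3)"
    using C by simp
  also have "\<dots> = 1 - snd y$3"
    unfolding y using y3 by simp
  finally have "C * ((snd y$2 - snd y$1) / (1 + snd y$3)) * ((snd y$1 + snd y$2) / C) = 1 - snd y$3" .
  then show ?case
    using C y3 by (simp add: Let_def prod_eq_iff vec3_eq_iff)
next
  case (11 p q v w)
  show ?case
    using C by (simp add: g_CD_def product_metric_def line_metric_def scale_metric_def dS2_metric_def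
        form12_def Let_def power2_eq_square field_simps)
qed (auto simp: product_metric_def line_metric_def scale_metric_def dS2_metric_def form12_def)

section \<open>The Heisenberg group\<close>

definition heis_metric :: "real \<Rightarrow> (real^3^3) metric_tensor" where
  "heis_metric D = (\<lambda>A X Y. (X$1$3 - A$1$2 * X$2$3) * (Y$1$3 - A$1$2 * Y$2$3)
    - (X$1$2 * Y$2$3 + X$2$3 * Y$1$2) / D)"

lemma Heis_iff: "A \<in> Heis \<longleftrightarrow> A$1$1 = 1 \<and> A$2$2 = 1 \<and> A$3$3 = 1 \<and> A$2$1 = 0 \<and> A$3$1 = 0 \<and> A$3$2 = 0"
proof -
  have "A \<in> Heis \<longleftrightarrow> A - mat 1 \<in> lcarrier heis"
    unfolding Heis_def by (auto intro!: exI[of _ "A - mat 1"])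
  then show ?thesis
    by (auto simp: heis_simps mat_def)
qed

text \<open>With a, b, c the entries 12, 23, 13, the metric is (dc - a db)^2 - (2/D) da db, built
  from the left-invariant forms da, db and dc - a db.\<close>

lemma left_invariant_heis_metric:
  assumes "D \<noteq> 0"
  shows "left_invariant_metric Heis heis (heis_metric D)"
  unfolding left_invariant_metric_def
proof (intro conjI ballI impI)
  fix A :: "real^3^3" assume A: "A \<in> Heis"
  show "bilinear (heis_metric D A)"
    by (auto simp: bilinear_def heis_metric_def intro!: linearI)
      (simp_all add: algebra_simps add_divide_distrib)
  fix X assume X: "X \<in> group_tangent heis A"
  show "heis_metric D A X Y = heis_metric D A Y X" for Y
    by (simp add: heis_metric_def algebra_simps)
  assume 0: "\<forall>Y\<in>group_tangent heis A. heis_metric D A X Y = 0"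
  have "heis_metric D A X (A ** heis_matrix a b c) = 0" for a b c
    using 0 by (auto simp: group_tangent_def heis_simps heis_matrix_nth)
  from this[of 1 0 0] this[of 0 1 0] this[of 0 0 1]
  show "X = 0"
    using A X assms by (auto simp: heis_metric_def matrix_mult_3 heis_matrix_nth Heis_iff
        group_tangent_def heis_simps mat3_eq_iff)
next
  fix A B X Y assume "A \<in> Heis" "B \<in> Heis" "X \<in> group_tangent heis B" "Y \<in> group_tangent heis B"
  then show "heis_metric D (A ** B) (A ** X) (A ** Y) = heis_metric D B X Y"
    by (auto simp: heis_metric_def matrix_mult_3 Heis_iff group_tangent_def heis_simps algebra_simps)
qed

lemma locally_isometric_Heis:
  assumes "open U" and D: "D \<noteq> 0"
  shows "locally_isometric U (g_CD (D\<^sup>2) D) Heis (heis_metric D)"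
  using assms(1)
\<comment> \<open>Substituting a = -D z, b = h, c = x gives (dx + D z dh)^2 + 2 dh dz.\<close>
proof (rule locally_isometric_g_CDI[where V = "\<lambda>_. UNIV" and W = UNIV
      and \<phi> = "\<lambda>_ q. vector [vector [1, - (D * q$3), q$1], vector [0, 1, q$2], vector [0, 0, 1]]"
      and \<phi>' = "\<lambda>_ q v. vector [vector [0, - (D * v$3), v$1], vector [0, 0, v$2], vector [0, 0, 0]]"
      and \<psi> = "\<lambda>_ A. vector [A$1$3, A$2$3, - A$1$2 / D]"], goal_cases)
  case (3 p)
  show ?case
    by (intro smooth_vector_intros)
next
  case (4 p q)
  show ?case
    by (intro has_derivative_vector_3) (auto intro!: nth_derivative_intros)
next
  case (6 p)
  show ?case
    by (intro continuous_on_vector_3 continuous_intros) (use D in auto)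
qed (use D in \<open>auto simp: heis_metric_def Heis_iff mat3_eq_iff vec3_eq_iff g_CD_def power2_eq_square field_simps\<close>)

section \<open>Left-invariant metrics on SL(2)\<close>

definition adjugate2 :: "real^2^2 \<Rightarrow> real^2^2" where
  "adjugate2 A = vector [vector [A$2$2, - A$1$2], vector [- A$2$1, A$1$1]]"

text \<open>For det A = 1 the adjugate is the inverse, so P and Q are values of the Maurer-Cartan
  form. The form on sl(2) is invariant under conjugation by diagonal matrices, the source of the
  fourth Killing field.\<close>

definition sl2_metric :: "real \<Rightarrow> real \<Rightarrow> (real^2^2) metric_tensor" where
  "sl2_metric k m = (\<lambda>A X Y. let P = adjugate2 A ** X; Q = adjugate2 A ** Y in
    P$1$1 * Q$1$1 / k\<^sup>2 + (P$1$2 * Q$2$1 + P$2$1 * Q$1$2) / m)"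

lemma adjugate2_mult: "adjugate2 (A ** B) = adjugate2 B ** adjugate2 A"
  by (simp add: mat2_simps adjugate2_def algebra_simps)

lemma adjugate2_inverse: "det A = 1 \<Longrightarrow> adjugate2 A ** A = mat 1"
  by (simp add: mat2_simps adjugate2_def mat_def det_2 algebra_simps)

text \<open>The metric sees A and X only through the inverse of A times X, which left translation
  preserves. Nondegeneracy is thereby tested at the identity, on three basis vectors.\<close>

lemma left_invariant_sl2_metric:
  assumes "k \<noteq> 0" and "m \<noteq> 0"
  shows "left_invariant_metric SL2 sl2 (sl2_metric k m)"
  unfolding left_invariant_metric_def
proof (intro conjI ballI impI)
  fix A :: "real^2^2" assume A: "A \<in> SL2"
  show "bilinear (sl2_metric k m A)"
    by (auto simp: bilinear_def sl2_metric_def matrix_mult_2 intro!: linearI)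
      (simp_all add: algebra_simps add_divide_distrib diff_divide_distrib)
  fix X assume X: "X \<in> group_tangent sl2 A"
  have "a * b / k\<^sup>2 + (c * d + e * f) / m = b * a / k\<^sup>2 + (f * e + d * c) / m" for a b c d e f :: real
    by (simp add: algebra_simps)
  then show "sl2_metric k m A X Y = sl2_metric k m A Y X" for Y
    unfolding sl2_metric_def Let_def .
  assume 0: "\<forall>Y\<in>group_tangent sl2 A. sl2_metric k m A X Y = 0"
  obtain Z where Z: "Z \<in> lcarrier sl2" "X = A ** Z"
    using X by (auto simp: group_tangent_def)
  have id: "adjugate2 A ** (A ** B) = B" for B
    using A adjugate2_inverse[of A] by (simp add: SL2_def matrix_mul_assoc)
  have "sl2_metric k m A X (A ** sl2_of_vec v) = 0" for v
    using 0 by (auto simp: group_tangent_def sl2_simps sl2_of_vec_def)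
  from this[of "vector [1, 0, 0]"] this[of "vector [0, 1, 0]"] this[of "vector [0, 0, 1]"]
  have "Z = 0"
    using Z(1) assms by (auto simp: Z(2) sl2_metric_def id sl2_of_vec_def sl2_simps mat2_eq_iff)
  then show "X = 0"
    by (simp add: Z(2))
next
  fix A B X Y :: "real^2^2" assume "A \<in> SL2"
  then have "adjugate2 (A ** B) ** (A ** X) = adjugate2 B ** X" for X :: "real^2^2"
    using adjugate2_inverse[of A]
    by (simp add: adjugate2_mult SL2_def matrix_mul_assoc)
      (simp add: matrix_mul_assoc[symmetric])
  then show "sl2_metric k m (A ** B) (A ** X) (A ** Y) = sl2_metric k m B X Y"
    by (simp add: sl2_metric_def)
qed

text \<open>The product of the unipotent matrix with entry \<open>h\<close>, the diagonal matrix with entry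
  \<open>e\<^sup>k\<^sup>x\<close>, and the lower unipotent matrix with entry \<open>m z e\<^sup>2\<^sup>k\<^sup>x\<close>: the Gauss decomposition.\<close>

definition sl2_chart :: "real \<Rightarrow> real \<Rightarrow> real^3 \<Rightarrow> real^2^2" where
  "sl2_chart k m q = vector [
    vector [exp (k * q$1) * (1 + m * q$2 * q$3), q$2 * exp (- (k * q$1))],
    vector [m * q$3 * exp (k * q$1), exp (- (k * q$1))]]"

definition sl2_chart_deriv :: "real \<Rightarrow> real \<Rightarrow> real^3 \<Rightarrow> real^3 \<Rightarrow> real^2^2" where
  "sl2_chart_deriv k m q v = vector [
    vector [exp (k * q$1) * (k * v$1 * (1 + m * q$2 * q$3) + m * (v$2 * q$3 + q$2 * v$3)),
      exp (- (k * q$1)) * (v$2 - k * v$1 * q$2)],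
    vector [m * exp (k * q$1) * (v$3 + k * v$1 * q$3), - (k * v$1 * exp (- (k * q$1)))]]"

text \<open>In the chart the second column is (h, 1) times exp(-k x), and the two entries of the
  second row multiply to m z.\<close>

definition sl2_chart_inv :: "real \<Rightarrow> real \<Rightarrow> real^2^2 \<Rightarrow> real^3" where
  "sl2_chart_inv k m A = vector [- (ln (A$2$2) / k), A$1$2 / A$2$2, A$2$1 * A$2$2 / m]"

lemma exp_mult_exp_minus: "exp (t::real) * exp (- t) = 1"
  by (simp flip: exp_add)

lemma smooth_on_sl2_chart: "smooth_on UNIV (sl2_chart k m)"
  unfolding sl2_chart_def by (intro smooth_vector_intros)

lemma has_derivative_sl2_chart: "(sl2_chart k m has_derivative sl2_chart_deriv k m q) (at q)"
  unfolding sl2_chart_def sl2_chart_deriv_def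
  by (intro has_derivative_vector_2) (auto intro!: nth_derivative_intros simp: algebra_simps)

lemma det_sl2_chart: "det (sl2_chart k m q) = 1"
  using exp_mult_exp_minus[of "k * q$1"] unfolding det_2 sl2_chart_def vector_2 by algebra

lemma sl2_chart_inv_chart: "k \<noteq> 0 \<Longrightarrow> m \<noteq> 0 \<Longrightarrow> sl2_chart_inv k m (sl2_chart k m q) = q"
  using exp_mult_exp_minus[of "k * q$1"]
  by (simp add: sl2_chart_inv_def sl2_chart_def vec3_eq_iff mult.assoc)

text \<open>Three entries agree by construction; the entry 11 follows from det A = 1.\<close>

lemma sl2_chart_chart_inv:
  assumes "k \<noteq> 0" and "m \<noteq> 0" and "det A = 1" and "A$2$2 > 0"
  shows "sl2_chart k m (sl2_chart_inv k m A) = A"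
  using assms
  by (simp add: sl2_chart_inv_def sl2_chart_def mat2_eq_iff exp_minus det_2 field_simps)

lemma continuous_on_sl2_chart_inv: "k \<noteq> 0 \<Longrightarrow> m \<noteq> 0 \<Longrightarrow> continuous_on {A. A$2$2 > 0} (sl2_chart_inv k m)"
  unfolding sl2_chart_inv_def by (intro continuous_on_vector_3 continuous_intros) auto

text \<open>The pullback is (dx + (m/k) z dh)^2 + 2 dh dz - 2 m z^2 dh^2, which dictates the
  relations of D and C to k and m.\<close>

lemma sl2_metric_chart:
  assumes "k \<noteq> 0" and "m \<noteq> 0" and "D = m / k" and "C = D\<^sup>2 - 2 * m"
  shows "g_CD C D q v w = sl2_metric k m (sl2_chart k m q) (sl2_chart_deriv k m q v) (sl2_chart_deriv k m q w)"
proof -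
  define e E where "e = exp (- (k * q$1))" and "E = exp (k * q$1)"
  have eE: "E * e = 1"
    using exp_mult_exp_minus by (simp add: e_def E_def)
  let ?P = "\<lambda>v. adjugate2 (sl2_chart k m q) ** sl2_chart_deriv k m q v"
  \<comment> \<open>The Maurer-Cartan form in the chart. The exponential factors of the entries 12
    and 21 are inverse to each other, so they cancel in the metric.\<close>
  have P: "?P v $ 1 $ 1 = k * v$1 + m * q$3 * v$2" "?P v $ 1 $ 2 = e * e * v$2"
    "?P v $ 2 $ 1 = E * E * m * (v$3 - m * q$3 * q$3 * v$2)" for v
    using eE unfolding matrix_mult_2 adjugate2_def sl2_chart_def sl2_chart_deriv_def vector_2
      e_def[symmetric] E_def[symmetric] by algebra+
  have "?P v $ 1 $ 2 * ?P w $ 2 $ 1 = m * v$2 * (w$3 - m * q$3 * q$3 * w$2)" for v w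
    unfolding P using eE by algebra
  then have "sl2_metric k m (sl2_chart k m q) (sl2_chart_deriv k m q v) (sl2_chart_deriv k m q w) =
     (k * v$1 + m * q$3 * v$2) * (k * w$1 + m * q$3 * w$2) / k\<^sup>2 +
     (m * v$2 * (w$3 - m * q$3 * q$3 * w$2) + m * w$2 * (v$3 - m * q$3 * q$3 * v$2)) / m"
    by (simp add: sl2_metric_def P(1) mult.commute[of "?P v $ 2 $ 1"])
  also have "\<dots> = g_CD C D q v w"
    unfolding g_CD_def assms(3,4) using assms(1,2) by (simp add: power2_eq_square field_simps)
  finally show ?thesis ..
qed

lemma locally_isometric_SL2:
  assumes "open U" and k: "k \<noteq> 0" "m \<noteq> 0" "D = m / k" "C = D\<^sup>2 - 2 * m"
  shows "locally_isometric U (g_CD C D) SL2 (sl2_metric k m)"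
  using assms(1)
proof (rule locally_isometric_g_CDI[where V = "\<lambda>_. UNIV" and W = "{A. A$2$2 > 0}"
      and \<phi> = "\<lambda>_. sl2_chart k m" and \<phi>' = "\<lambda>_. sl2_chart_deriv k m" and \<psi> = "\<lambda>_. sl2_chart_inv k m"], goal_cases)
  case 5
  show ?case
    by (intro open_Collect_less continuous_intros)
next
  case (10 p w)
  show ?case
    by (simp add: sl2_metric_def)
next
  case (11 p q v w)
  show ?case
    by (rule sl2_metric_chart[OF k])
qed (use k in \<open>auto simp: SL2_def smooth_on_sl2_chart has_derivative_sl2_chart continuous_on_sl2_chart_inv
      det_sl2_chart sl2_chart_inv_chart sl2_chart_chart_inv, auto simp: sl2_chart_def\<close>)

section \<open>Anti-de Sitter space as SL(2)\<close>

definition vec4_of_mat :: "real^2^2 \<Rightarrow> real^4" where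
  "vec4_of_mat A = vector [(A$1$1 + A$2$2) / 2, (A$1$2 - A$2$1) / 2, (A$1$1 - A$2$2) / 2, (A$1$2 + A$2$1) / 2]"

definition mat_of_vec4 :: "real^4 \<Rightarrow> real^2^2" where
  "mat_of_vec4 p = vector [vector [p$1 + p$3, p$4 + p$2], vector [p$4 - p$2, p$1 - p$3]]"

lemma vec4_of_mat_inverse: "mat_of_vec4 (vec4_of_mat A) = A" "vec4_of_mat (mat_of_vec4 p) = p"
  by (simp_all add: vec4_of_mat_def mat_of_vec4_def mat2_eq_iff vec_eq_iff forall_4 field_simps)

lemma bounded_linear_vec4_of_mat: "bounded_linear vec4_of_mat"
  unfolding linear_conv_bounded_linear[symmetric]
  by (rule linearI) (simp_all add: vec4_of_mat_def vec_eq_iff forall_4 field_simps)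

lemma bounded_linear_mat_of_vec4: "bounded_linear mat_of_vec4"
  unfolding linear_conv_bounded_linear[symmetric]
  by (rule linearI) (simp_all add: mat_of_vec4_def mat2_eq_iff field_simps)

text \<open>The right side is the polar form of -det; the identification of 4-vectors with matrices
  is chosen for this.\<close>

lemma form22_vec4_of_mat:
  "form22 (vec4_of_mat X) (vec4_of_mat Y) =
    (X$1$2 * Y$2$1 + X$2$1 * Y$1$2 - X$1$1 * Y$2$2 - X$2$2 * Y$1$1) / 2"
  by (simp add: form22_def vec4_of_mat_def field_simps)

lemma AdS3_iff: "p \<in> AdS3 \<longleftrightarrow> det (mat_of_vec4 p) = 1"
  by (auto simp: AdS3_def form22_def mat_of_vec4_def det_2 algebra_simps)

lemma locally_isometric_AdS3:
  assumes "open U" and D: "D \<noteq> 0"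
  shows "locally_isometric U (g_CD 0 D) AdS3 (scale_metric (4 / D\<^sup>2) AdS3_metric)"
proof -
  \<comment> \<open>The solution of D = m/k and 0 = D^2 - 2 m. It satisfies m = 2 k^2, the ratio at
    which the form of \<open>sl2_metric\<close> on sl(2) becomes -det / k^2, hence conjugation
    invariant; and 1/k^2 is the scale 4/D^2.\<close>
  define k m where "k = D / 2" and "m = D\<^sup>2 / 2"
  have km: "k \<noteq> 0" "m \<noteq> 0" "m = 2 * k\<^sup>2" "D = 2 * k"
    using D by (simp_all add: k_def m_def power2_eq_square)
  have isom: "g_CD 0 D q v w = scale_metric (4 / D\<^sup>2) AdS3_metric p
    (vec4_of_mat (sl2_chart_deriv k m q v)) (vec4_of_mat (sl2_chart_deriv k m q w))" for p q v w
  proof -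
    define e E where "e = exp (- (k * q$1))" and "E = exp (k * q$1)"
    have eE: "E * e = 1"
      using exp_mult_exp_minus by (simp add: e_def E_def)
    \<comment> \<open>Twice the polar form of -det. As det is multiplicative, B can be evaluated on
      tangent vectors directly, without translating them to the identity.\<close>
    define B where "B = (\<lambda>(X :: real^2^2) (Y :: real^2^2). X$1$2 * Y$2$1 + X$2$1 * Y$1$2 - X$1$1 * Y$2$2 - X$2$2 * Y$1$1)"
    have "2 * k\<^sup>2 * g_CD 0 D q v w = B (sl2_chart_deriv k m q v) (sl2_chart_deriv k m q w)"
      unfolding B_def sl2_chart_deriv_def vector_2 e_def[symmetric] E_def[symmetric] g_CD_def km(3,4)
      using eE by algebra
    then show ?thesis
      unfolding scale_metric_def AdS3_metric_def form22_vec4_of_mat B_def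
      using km(1) by (simp add: km(4) power2_eq_square field_simps)
  qed
  show ?thesis
    using assms(1)
  proof (rule locally_isometric_g_CDI[where V = "\<lambda>_. UNIV" and W = "{p. p$1 - p$3 > 0}"
        and \<phi> = "\<lambda>_ q. vec4_of_mat (sl2_chart k m q)"
        and \<phi>' = "\<lambda>_ q v. vec4_of_mat (sl2_chart_deriv k m q v)"
        and \<psi> = "\<lambda>_ p. sl2_chart_inv k m (mat_of_vec4 p)"], goal_cases)
    case (3 p)
    show ?case
      by (rule smooth_on_linear_compose[OF open_UNIV bounded_linear_vec4_of_mat smooth_on_sl2_chart])
  next
    case (4 p q)
    show ?case
      by (rule bounded_linear.has_derivative[OF bounded_linear_vec4_of_mat has_derivative_sl2_chart])
  next
    case 5
    show ?case
      by (intro open_Collect_less continuous_intros)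
  next
    case (6 p)
    show ?case
      by (rule continuous_on_compose2[OF continuous_on_sl2_chart_inv[OF km(1,2)]
            linear_continuous_on[OF bounded_linear_mat_of_vec4]]) (auto simp: mat_of_vec4_def)
  next
    case (7 p q)
    show ?case
      by (simp add: AdS3_iff vec4_of_mat_inverse det_sl2_chart) (simp add: vec4_of_mat_def sl2_chart_def)
  next
    case (8 p q)
    show ?case
      by (simp add: vec4_of_mat_inverse sl2_chart_inv_chart km(1,2))
  next
    case (9 p y)
    then show ?case
      by (simp add: sl2_chart_chart_inv[OF km(1,2)] AdS3_iff vec4_of_mat_inverse) (simp add: mat_of_vec4_def
          sl2_chart_chart_inv[OF km(1,2)] vec4_of_mat_inverse(2)[unfolded mat_of_vec4_def])
  next
    case (11 p q v w)
    show ?case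
      by (rule isom)
  qed (auto simp: scale_metric_def AdS3_metric_def form22_def)
qed

theorem proposition10:
  fixes C D :: real and U :: "(real^3) set"
  assumes "open U" and "connected U" and "simply_connected U" and "0 \<in> U"
  shows
    "(D \<noteq> 0 \<and> C \<noteq> 0 \<and> C \<noteq> D\<^sup>2 \<longrightarrow>
        (\<exists>h. left_invariant_metric SL2 sl2 h \<and> locally_isometric U (g_CD C D) SL2 h) \<and>
        (\<exists>\<phi> f s. lie_iso \<phi> (killing_algebra (g_CD C D) U) (lie_sum (abelian_lie :: real lie_alg) sl2) \<and>
           R_semisimple_sl2 s \<and> lie_hom f (abelian_lie :: real lie_alg) sl2 \<and> range f \<subseteq> span {s} \<and>
           \<phi> ` isotropy (g_CD C D) U = {(t, f t) |t. True}))
     \<and> (D \<noteq> 0 \<and> C = D\<^sup>2 \<longrightarrow>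
        (\<exists>h. left_invariant_metric Heis heis h \<and> locally_isometric U (g_CD C D) Heis h) \<and>
        (\<exists>\<delta> \<phi>. lie_derivation heis \<delta> \<and> semisimple_on (lcarrier heis) \<delta> \<and>
           lie_iso \<phi> (killing_algebra (g_CD C D) U)
             (lie_semidirect (abelian_lie :: real lie_alg) heis (\<lambda>t X. t *\<^sub>R \<delta> X)) \<and>
           \<phi> ` isotropy (g_CD C D) U = {(t, 0) |t. True}))
     \<and> (C = 0 \<and> D \<noteq> 0 \<longrightarrow>
        locally_isometric U (g_CD C D) AdS3 (scale_metric (4 / D\<^sup>2) AdS3_metric) \<and>
        lie_isomorphic (killing_algebra (g_CD C D) U) (lie_sum sl2 sl2))
     \<and> (C \<noteq> 0 \<and> D = 0 \<longrightarrow>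
        locally_isometric U (g_CD C D) (UNIV \<times> dS2)
          (product_metric line_metric (scale_metric (1 / C) dS2_metric)) \<and>
        (\<exists>\<phi> s. lie_iso \<phi> (killing_algebra (g_CD C D) U) (lie_sum (abelian_lie :: real lie_alg) sl2) \<and>
           semisimple_sl2 s \<and>
           \<phi> ` isotropy (g_CD C D) U = {(0, t *\<^sub>R s) |t. True}))
     \<and> (C = 0 \<and> D = 0 \<longrightarrow>
        locally_isometric U (g_CD C D) Min3 Min3_metric \<and>
        lie_isomorphic (killing_algebra (g_CD C D) U)
          (lie_semidirect sl2 (abelian_lie :: (real^3) lie_alg) sl2_act))"
proof (intro conjI impI)
  note U = \<open>open U\<close> \<open>connected U\<close> \<open>0 \<in> U\<close>
  {
    assume CD: "D \<noteq> 0 \<and> C \<noteq> 0 \<and> C \<noteq> D\<^sup>2"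
    \<comment> \<open>Solves C = D^2 - 2 m, nonzero since C differs from D^2; the chart is then used
      with k = m/D.\<close>
    define m where "m = (D\<^sup>2 - C) / 2"
    have m: "m / D \<noteq> 0" "m \<noteq> 0" "D = m / (m / D)" "C = D\<^sup>2 - 2 * m"
      using CD by (simp_all add: m_def field_simps)
    show "\<exists>h. left_invariant_metric SL2 sl2 h \<and> locally_isometric U (g_CD C D) SL2 h"
      using left_invariant_sl2_metric[OF m(1,2)] locally_isometric_SL2[OF \<open>open U\<close> m] by blast
    show "\<exists>\<phi> f s. lie_iso \<phi> (killing_algebra (g_CD C D) U) (lie_sum (abelian_lie :: real lie_alg) sl2) \<and>
        R_semisimple_sl2 s \<and> lie_hom f (abelian_lie :: real lie_alg) sl2 \<and> range f \<subseteq> span {s} \<and>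
        \<phi> ` isotropy (g_CD C D) U = {(t, f t) |t. True}"
      using killing_algebra_generic[OF U] CD by blast
  next
    assume CD: "D \<noteq> 0 \<and> C = D\<^sup>2"
    then show "\<exists>h. left_invariant_metric Heis heis h \<and> locally_isometric U (g_CD C D) Heis h"
      using left_invariant_heis_metric[of D] locally_isometric_Heis[OF \<open>open U\<close>, of D] by auto
    from CD show "\<exists>\<delta> \<phi>. lie_derivation heis \<delta> \<and> semisimple_on (lcarrier heis) \<delta> \<and>
        lie_iso \<phi> (killing_algebra (g_CD C D) U)
          (lie_semidirect (abelian_lie :: real lie_alg) heis (\<lambda>t X. t *\<^sub>R \<delta> X)) \<and>
        \<phi> ` isotropy (g_CD C D) U = {(t, 0) |t. True}"
      using killing_algebra_heis[OF U] by simp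
  next
    assume "C = 0 \<and> D \<noteq> 0"
    then show "locally_isometric U (g_CD C D) AdS3 (scale_metric (4 / D\<^sup>2) AdS3_metric)"
      and "lie_isomorphic (killing_algebra (g_CD C D) U) (lie_sum sl2 sl2)"
      using locally_isometric_AdS3[OF \<open>open U\<close>] killing_algebra_AdS[OF U] by auto
  next
    assume "C \<noteq> 0 \<and> D = 0"
    then show "locally_isometric U (g_CD C D) (UNIV \<times> dS2)
          (product_metric line_metric (scale_metric (1 / C) dS2_metric))"
      and "\<exists>\<phi> s. lie_iso \<phi> (killing_algebra (g_CD C D) U) (lie_sum (abelian_lie :: real lie_alg) sl2) \<and>
        semisimple_sl2 s \<and> \<phi> ` isotropy (g_CD C D) U = {(0, t *\<^sub>R s) |t. True}"
      using locally_isometric_R_dS2[OF \<open>open U\<close>] killing_algebra_product[OF U] by simp_all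
  next
    assume "C = 0 \<and> D = 0"
    then show "locally_isometric U (g_CD C D) Min3 Min3_metric"
      and "lie_isomorphic (killing_algebra (g_CD C D) U)
          (lie_semidirect sl2 (abelian_lie :: (real^3) lie_alg) sl2_act)"
      using locally_isometric_Min3[OF \<open>open U\<close>] killing_algebra_Min[OF U] by auto
  }
qed

end
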